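(* Let $\mathbf{A}=[\mathbf{a}_1,\ldots,\mathbf{a}_d]\in\mathbb{R}^{n\times d}$ be a matrix of rank $t\leq \min\{d,n\}$. For each $1\leq i\leq t$, let $\lambda_i$ be the $i$-th largest eigenvalue of $\mathbf{A}^{\rm T}\mathbf{A}$, and assume $\lambda_t<\lambda_1$. Let $\alpha$ and $\beta$ be the real numbers defined by \[ \alpha^{-1}=\frac{1}{t} \sum_{i=1}^t \lambda_i^{-1}\quad\text{and}\quad \beta=\frac{\lambda_t^{-1}-\alpha^{-1}}{\lambda_t^{-1}-\lambda_1^{-1}}\in(0,1). \] Then for any positive integer $k$ satisfying $\beta\cdot t\leq k< t$, there exists a subset $S\subset[d]$ of size $k$ such that $\mathrm{rank}(\mathbf{A}_S)=k$ and \[ \Vert\mathbf{A}-\mathbf{A}_{S}\mathbf{A}_{S}^{\dagger}\mathbf{A} \Vert_2^2\leq \frac{1}{1+(\Vert\mathbf{A}\Vert_2^2\cdot \alpha^{-1}-1)\cdot \gamma_{\mathbf{A},k}}\cdot \Vert\mathbf{A}\Vert_2^2, \] where $\gamma_{\mathbf{A},k}:=\Big(\sqrt{\frac{k}{t}}-\sqrt{\frac{\beta}{1-\beta}\cdot (1-\frac{k}{t})} \Big)^2\in[0,1)$.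
   Context: $[d]=\{1,\ldots,d\}$. For $S\subset[d]$, $\mathbf{A}_S\in\mathbb{R}^{n\times |S|}$ denotes the submatrix of $\mathbf{A}$ consisting of the columns indexed by $S$, and $\mathbf{A}_S^{\dagger}$ denotes the Moore–Penrose pseudoinverse of $\mathbf{A}_S$. $\Vert\cdot\Vert_2$ is the spectral norm. *)

theory Defs
  imports
    Complex_Main
    "HOL-Library.Multiset"
    "HOL-Computational_Algebra.Polynomial"
    "Jordan_Normal_Form.Char_Poly"
    "Jordan_Normal_Form.DL_Rank"
    "Jordan_Normal_Form.DL_Submatrix"
begin

(* Matrices are indexed from 0, so the column index set [d] is {0..<d}. *)
definition column_submatrix :: "'a mat \<Rightarrow> nat set \<Rightarrow> 'a mat" where
  "column_submatrix A S = submatrix A UNIV S"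

definition euclidean_norm :: "real vec \<Rightarrow> real" where
  "euclidean_norm v = sqrt (v \<bullet> v)"

(* The operator norm induced by the Euclidean norms.  Taking the closed unit ball instead of the
   unit sphere keeps the set nonempty when the matrix has no columns. *)
definition spectral_norm :: "real mat \<Rightarrow> real" where
  "spectral_norm A =
    Sup {euclidean_norm (A *\<^sub>v x) | x. x \<in> carrier_vec (dim_col A) \<and> euclidean_norm x \<le> 1}"

(* The four Penrose conditions for real matrices. *)
definition is_pseudoinverse :: "real mat \<Rightarrow> real mat \<Rightarrow> bool" where
  "is_pseudoinverse A X \<longleftrightarrow>
    X \<in> carrier_mat (dim_col A) (dim_row A) \<and>
    A * X * A = A \<and>
    X * A * X = X \<and>
    transpose_mat (A * X) = A * X \<and>
    transpose_mat (X * A) = X * A"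

definition pseudoinverse :: "real mat \<Rightarrow> real mat" where
  "pseudoinverse A = (THE X. is_pseudoinverse A X)"

(* Real eigenvalues are listed with algebraic multiplicity and counted from i = 1; for a real
   symmetric matrix this lists all of its eigenvalues. *)
definition nth_largest_eigenvalue :: "real mat \<Rightarrow> nat \<Rightarrow> real" where
  "nth_largest_eigenvalue M i =
    rev (sorted_list_of_multiset (proots (char_poly M))) ! (i - 1)"

end

theory Submission
  imports Defs
begin

text \<open>
  Eliminating the columns of \<open>A\<close> one at a time turns \<open>M = A\<^sup>T A\<close> successively into its Schur
  complements \<open>N - N e\<^sub>i e\<^sub>i\<^sup>T N / N\<^sub>i\<^sub>i\<close>; after the columns in \<open>S\<close> have been used, \<open>N\<close> is the Gram matrix
  of \<open>A - A\<^sub>S A\<^sub>S\<^sup>\<dagger> A\<close>, so its largest eigenvalue has to be bounded by \<open>1 / x\<close>.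

  Let \<open>G = N (I - p N)\<^sup>-\<^sup>1\<close>, whose trace is the barrier \<open>\<Sum> 1 / (1 / \<mu> - p)\<close> over the positive
  eigenvalues \<open>\<mu>\<close> of \<open>N\<close>.  Taking Schur complements commutes with \<open>N \<mapsto> G\<close>.  Averaging over \<open>i\<close> with
  weights \<open>G\<^sub>i\<^sub>i\<close> (volume sampling) yields an \<open>i\<close> whose elimination lowers the trace by at least
  \<open>tr G\<^sup>2 / tr G\<close>, and by Chebyshev's sum inequality this pays for first moving \<open>p\<close> to the right by any
  \<open>\<delta> < 1 / tr G\<close>.  So if the initial trace is at most \<open>\<phi>\<close>, then \<open>k\<close> eliminations with
  \<open>\<delta> = k / ((k + 1) \<phi>)\<close> and one further move reach \<open>x = p + (k + 1) \<delta> = p + k / \<phi>\<close>.  No interlacing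
  is needed, since \<open>p\<close> always stays to the left of all \<open>1 / \<mu>\<close>.

  By convexity the initial trace is at most its value when a fraction \<open>\<beta>\<close> of the \<open>1 / \<lambda>\<^sub>i\<close> sits at
  \<open>1 / \<lambda>\<^sub>1\<close> and the rest at \<open>1 / \<lambda>\<^sub>t\<close>; optimising the initial \<open>p\<close> gives the constant.
\<close>

section \<open>Positive semidefinite forms and Schur complements\<close>

text \<open>Matrices are functions on indices, of which only the entries below \<open>d\<close>
  count. The size thus stays fixed during the elimination.\<close>

definition qform :: "nat \<Rightarrow> (nat \<Rightarrow> nat \<Rightarrow> real) \<Rightarrow> (nat \<Rightarrow> real) \<Rightarrow> real" where
  "qform d f v = (\<Sum>a<d. \<Sum>b<d. v a * f a b * v b)"

definition psd :: "nat \<Rightarrow> (nat \<Rightarrow> nat \<Rightarrow> real) \<Rightarrow> bool" where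
  "psd d f \<longleftrightarrow> (\<forall>a<d. \<forall>b<d. f a b = f b a) \<and> (\<forall>v. 0 \<le> qform d f v)"

definition mtrace :: "nat \<Rightarrow> (nat \<Rightarrow> nat \<Rightarrow> real) \<Rightarrow> real" where
  "mtrace d f = (\<Sum>a<d. f a a)"

text \<open>Index \<open>i\<close> is kept: for \<open>f i i \<noteq> 0\<close> its row and column
  become zero instead of being deleted.\<close>

definition schur :: "nat \<Rightarrow> (nat \<Rightarrow> nat \<Rightarrow> real) \<Rightarrow> nat \<Rightarrow> nat \<Rightarrow> real" where
  "schur i f a b = f a b - f a i * f i b / f i i"

lemma psd_sym: "psd d f \<Longrightarrow> a < d \<Longrightarrow> b < d \<Longrightarrow> f a b = f b a"
  and psd_qform: "psd d f \<Longrightarrow> 0 \<le> qform d f v"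
  by (auto simp: psd_def)

lemma if_sum_zero: "(\<Sum>b\<in>B. if P then h b else 0) = (if P then \<Sum>b\<in>B. h b else (0::real))"
  by simp

lemma qform_add_unit:
  assumes sym: "\<And>a b. a < d \<Longrightarrow> b < d \<Longrightarrow> f a b = f b a" and i: "i < d"
  shows "qform d f (\<lambda>a. v a + (if a = i then s else 0)) =
    qform d f v + 2 * s * (\<Sum>b<d. f i b * v b) + s\<^sup>2 * f i i"
proof -
  have "qform d f (\<lambda>a. v a + (if a = i then s else 0)) =
    (\<Sum>a<d. \<Sum>b<d. v a * f a b * v b + (if b = i then v a * f a b * s else 0)
      + (if a = i then s * f a b * v b else 0) + (if a = i then if b = i then s * f a b * s else 0 else 0))"
    unfolding qform_def by (intro sum.cong refl) (auto simp: algebra_simps)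
  also have "\<dots> = qform d f v + (\<Sum>a<d. v a * f a i * s) + (\<Sum>b<d. s * f i b * v b) + s * f i i * s"
    using i unfolding qform_def
    by (simp add: sum.distrib if_sum_zero)
  also have "(\<Sum>a<d. v a * f a i * s) = (\<Sum>b<d. s * f i b * v b)"
    using i sym[OF _ i] by (intro sum.cong) auto
  finally show ?thesis
    by (simp add: power2_eq_square sum_distrib_left algebra_simps)
qed

lemma qform_schur:
  assumes sym: "\<And>a b. a < d \<Longrightarrow> b < d \<Longrightarrow> f a b = f b a" and i: "i < d"
  shows "qform d (schur i f) v = qform d f v - (\<Sum>b<d. f i b * v b)\<^sup>2 / f i i"
proof -
  have "qform d (schur i f) v = qform d f v - (\<Sum>a<d. \<Sum>b<d. (f i a * v a) * (f i b * v b)) / f i i"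
    unfolding qform_def schur_def sum_subtractf[symmetric] sum_divide_distrib
  proof (intro sum.cong refl)
    fix a b assume "a \<in> {..<d}"
    then have "f a i = f i a" using sym i by auto
    then show "v a * (f a b - f a i * f i b / f i i) * v b =
      v a * f a b * v b - f i a * v a * (f i b * v b) / f i i"
      by (simp only:) (simp add: algebra_simps)
  qed
  also have "(\<Sum>a<d. \<Sum>b<d. (f i a * v a) * (f i b * v b)) = (\<Sum>b<d. f i b * v b)\<^sup>2"
    by (simp add: power2_eq_square sum_product)
  finally show ?thesis .
qed

text \<open>The form of the complement at \<open>v\<close> is the minimum of the form of
  \<open>f\<close> over the line \<open>v + s e_i\<close>, attained at the vertex
  \<open>s = - r / f i i\<close>.\<close>

lemma psd_schur:
  assumes f: "psd d f" and i: "i < d" and pos: "f i i > 0"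
  shows "psd d (schur i f)"
  unfolding psd_def
proof (intro conjI allI impI)
  fix a b assume "a < d" "b < d"
  then show "schur i f a b = schur i f b a"
    using psd_sym[OF f] i by (simp add: schur_def mult.commute)
next
  fix v
  have sym: "\<And>a b. a < d \<Longrightarrow> b < d \<Longrightarrow> f a b = f b a" by (rule psd_sym[OF f])
  define r where "r = (\<Sum>b<d. f i b * v b)"
  have "0 \<le> qform d f (\<lambda>a. v a + (if a = i then - r / f i i else 0))"
    by (rule psd_qform[OF f])
  also have "\<dots> = qform d f v - r\<^sup>2 / f i i"
  proof -
    have "2 * (- r / f i i) * r + (- r / f i i)\<^sup>2 * f i i = - r\<^sup>2 / f i i"
      using pos by (simp add: power2_eq_square)
    then show ?thesis
      using qform_add_unit[of d f i v "- r / f i i", OF sym i] by (simp only: r_def[symmetric])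
  qed
  also have "\<dots> = qform d (schur i f) v"
    using qform_schur[of d f i v, OF sym i] by (simp add: r_def)
  finally show "0 \<le> qform d (schur i f) v" .
qed

lemma qform_unit:
  assumes f: "psd d f" and i: "i < d"
  shows "qform d f (\<lambda>a. if a = i then 1 else 0) = f i i"
  using qform_add_unit[of d f i "\<lambda>_. 0" 1] psd_sym[OF f] i by (simp add: qform_def)

lemma psd_diag_nonneg: "psd d f \<Longrightarrow> i < d \<Longrightarrow> 0 \<le> f i i"
  using psd_qform[of d f "\<lambda>a. if a = i then 1 else 0"] by (simp add: qform_unit)

text \<open>Along e_i the form is affine in \<open>s\<close>, so a nonzero slope would make it
  negative somewhere; the \<open>s\<close> chosen below gives the value -1.\<close>

lemma psd_diag_zero:
  assumes f: "psd d f" and i: "i < d" and z: "f i i = 0" and a: "a < d"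
  shows "f i a = 0"
proof (rule ccontr)
  assume nz: "f i a \<noteq> 0"
  define v where "v = (\<lambda>b. if b = a then 1 else 0 :: real)"
  have sym: "\<And>a b. a < d \<Longrightarrow> b < d \<Longrightarrow> f a b = f b a" by (rule psd_sym[OF f])
  have v: "qform d f v = f a a" "(\<Sum>b<d. f i b * v b) = f i a"
    using a qform_unit[OF f a] by (simp_all add: v_def if_distrib[of "\<lambda>x. _ * x"] cong: if_cong)
  define s where "s = - (f a a + 1) / (2 * f i a)"
  have "0 \<le> qform d f (\<lambda>b. v b + (if b = i then s else 0))"
    by (rule psd_qform[OF f])
  also have "\<dots> = f a a + 2 * s * f i a"
    using qform_add_unit[of d f i v s, OF sym i] z by (simp add: v)
  also have "\<dots> = -1" using nz by (simp add: s_def field_simps)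
  finally show False by simp
qed

lemma psd_mtrace_nonneg: "psd d f \<Longrightarrow> 0 \<le> mtrace d f"
  unfolding mtrace_def by (intro sum_nonneg) (auto intro: psd_diag_nonneg)

lemma psd_mtrace_zero:
  assumes f: "psd d f" and z: "mtrace d f = 0" and "a < d" "b < d"
  shows "f a b = 0"
proof -
  have "\<forall>a\<in>{..<d}. f a a = 0"
    using z psd_diag_nonneg[OF f] unfolding mtrace_def by (subst (asm) sum_nonneg_eq_0_iff) auto
  then show ?thesis using psd_diag_zero[OF f] assms by auto
qed

section \<open>Matrix products and shifts of the inverse\<close>

definition mprod :: "nat \<Rightarrow> (nat \<Rightarrow> nat \<Rightarrow> real) \<Rightarrow> (nat \<Rightarrow> nat \<Rightarrow> real) \<Rightarrow> nat \<Rightarrow> nat \<Rightarrow> real" where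
  "mprod d f g a b = (\<Sum>c<d. f a c * g c b)"

lemma mprod_assoc: "mprod d (mprod d f g) h = mprod d f (mprod d g h)"
proof (intro ext)
  fix a b
  have "mprod d (mprod d f g) h a b = (\<Sum>c<d. \<Sum>e<d. f a e * g e c * h c b)"
    by (simp add: mprod_def sum_distrib_right)
  also have "\<dots> = (\<Sum>e<d. \<Sum>c<d. f a e * g e c * h c b)" by (rule sum.swap)
  also have "\<dots> = mprod d f (mprod d g h) a b"
    by (simp add: mprod_def sum_distrib_left mult.assoc)
  finally show "mprod d (mprod d f g) h a b = mprod d f (mprod d g h) a b" .
qed

text \<open>\<open>G = N (I - x N)\<^sup>-\<^sup>1\<close>, stated without an inverse.\<close>

definition shifted :: "nat \<Rightarrow> real \<Rightarrow> (nat \<Rightarrow> nat \<Rightarrow> real) \<Rightarrow> (nat \<Rightarrow> nat \<Rightarrow> real) \<Rightarrow> bool" where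
  "shifted d x G N \<longleftrightarrow> (\<forall>a<d. \<forall>b<d. G a b - N a b = x * mprod d G N a b)"

lemma shiftedD: "shifted d x G N \<Longrightarrow> a < d \<Longrightarrow> b < d \<Longrightarrow> G a b - N a b = x * mprod d G N a b"
  by (simp add: shifted_def)

text \<open>For invertible matrices \<open>shifted\<close> means G^-1 = N^-1 - x I, and a Schur
  complement deletes row and column \<open>i\<close> of the inverse. In general the product of the
  complements only involves the entries (a,b), (a,i), (i,b), (i,i) of \<open>mprod d G N\<close>,
  and the relation at these four places suffices.\<close>

lemma shifted_schur:
  assumes s: "shifted d x G N" and i: "i < d" and G: "G i i \<noteq> 0" and N: "N i i \<noteq> 0"
  shows "shifted d x (schur i G) (schur i N)"
  unfolding shifted_def
proof (intro allI impI)
  fix a b assume a: "a < d" and b: "b < d"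
  have "mprod d (schur i G) (schur i N) a b =
    (\<Sum>c<d. G a c * N c b - G a c * N c i * (N i b / N i i)
       - (G a i / G i i) * (G i c * N c b) + (G a i / G i i) * (G i c * N c i) * (N i b / N i i))"
    unfolding mprod_def schur_def by (intro sum.cong refl) (simp add: algebra_simps)
  also have "\<dots> = mprod d G N a b - mprod d G N a i * (N i b / N i i)
       - (G a i / G i i) * mprod d G N i b + (G a i / G i i) * mprod d G N i i * (N i b / N i i)"
    unfolding mprod_def by (simp only: sum.distrib sum_subtractf sum_distrib_left sum_distrib_right)
  finally have "x * mprod d (schur i G) (schur i N) a b =
    (G a b - N a b) - (G a i - N a i) * (N i b / N i i)
       - (G a i / G i i) * (G i b - N i b) + (G a i / G i i) * (G i i - N i i) * (N i b / N i i)"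
    unfolding shiftedD[OF s a b] shiftedD[OF s a i] shiftedD[OF s i b] shiftedD[OF s i i]
    by (simp only:) (simp add: algebra_simps)
  also have "\<dots> = schur i G a b - schur i N a b"
    using G N by (simp add: schur_def field_simps)
  finally show "schur i G a b - schur i N a b = x * mprod d (schur i G) (schur i N) a b" by simp
qed

text \<open>In terms of inverses, the shifts simply add. Without inverses, the two error terms are
  both \<open>x * y\<close> times the product K G N and cancel by associativity.\<close>

lemma shifted_trans:
  assumes s: "shifted d x G N" and s': "shifted d y K G"
  shows "shifted d (x + y) K N"
  unfolding shifted_def
proof (intro allI impI)
  fix a b assume a: "a < d" and b: "b < d"
  have 1: "mprod d K G a b - mprod d K N a b = x * mprod d K (mprod d G N) a b"
  proof -
    have "mprod d K G a b - mprod d K N a b = (\<Sum>c<d. K a c * (G c b - N c b))"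
      by (simp add: mprod_def sum_subtractf algebra_simps)
    also have "\<dots> = (\<Sum>c<d. K a c * (x * mprod d G N c b))"
      using shiftedD[OF s _ b] by (intro sum.cong) auto
    finally show ?thesis by (simp add: mprod_def[of d K] sum_distrib_left algebra_simps)
  qed
  have 2: "mprod d K N a b - mprod d G N a b = y * mprod d (mprod d K G) N a b"
  proof -
    have "mprod d K N a b - mprod d G N a b = (\<Sum>c<d. (K a c - G a c) * N c b)"
      by (simp add: mprod_def sum_subtractf algebra_simps)
    also have "\<dots> = (\<Sum>c<d. (y * mprod d K G a c) * N c b)"
      using shiftedD[OF s' a] by (intro sum.cong) auto
    finally show ?thesis by (simp add: mprod_def[of d _ N] sum_distrib_left algebra_simps)
  qed
  have "K a b - N a b = y * mprod d K G a b + x * mprod d G N a b"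
    using shiftedD[OF s a b] shiftedD[OF s' a b] by simp
  also have "\<dots> = (x + y) * mprod d K N a b + y * (mprod d K G a b - mprod d K N a b)
      - x * (mprod d K N a b - mprod d G N a b)" by (simp add: algebra_simps)
  also have "\<dots> = (x + y) * mprod d K N a b" unfolding 1 2 mprod_assoc by simp
  finally show "K a b - N a b = (x + y) * mprod d K N a b" .
qed

section \<open>Functional calculus in an orthonormal eigenbasis\<close>

definition orthonormal :: "nat \<Rightarrow> (nat \<Rightarrow> nat \<Rightarrow> real) \<Rightarrow> bool" where
  "orthonormal d Q \<longleftrightarrow> (\<forall>a<d. \<forall>b<d. (\<Sum>c<d. Q c a * Q c b) = (if a = b then 1 else 0))"

text \<open>The matrix Q diag(g) Q^T; for orthonormal \<open>Q\<close>, column \<open>c\<close> of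
  \<open>Q\<close> is an eigenvector for \<open>g c\<close>.\<close>

definition spectral_sum :: "nat \<Rightarrow> (nat \<Rightarrow> nat \<Rightarrow> real) \<Rightarrow> (nat \<Rightarrow> real) \<Rightarrow> nat \<Rightarrow> nat \<Rightarrow> real" where
  "spectral_sum d Q g a b = (\<Sum>c<d. g c * Q a c * Q b c)"

lemma mprod_spectral_sum:
  assumes Q: "orthonormal d Q"
  shows "mprod d (spectral_sum d Q f) (spectral_sum d Q g) a b = spectral_sum d Q (\<lambda>c. f c * g c) a b"
proof -
  have "mprod d (spectral_sum d Q f) (spectral_sum d Q g) a b =
    (\<Sum>c<d. \<Sum>p<d. \<Sum>q<d. f p * Q a p * (g q * Q b q) * (Q c p * Q c q))"
    by (simp add: mprod_def spectral_sum_def sum_product algebra_simps)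
  also have "\<dots> = (\<Sum>p<d. \<Sum>c<d. \<Sum>q<d. f p * Q a p * (g q * Q b q) * (Q c p * Q c q))"
    by (rule sum.swap)
  also have "\<dots> = (\<Sum>p<d. \<Sum>q<d. \<Sum>c<d. f p * Q a p * (g q * Q b q) * (Q c p * Q c q))"
    by (intro sum.cong refl sum.swap)
  also have "\<dots> = (\<Sum>p<d. \<Sum>q<d. f p * Q a p * (g q * Q b q) * (if p = q then 1 else 0))"
    unfolding sum_distrib_left[symmetric] using Q by (intro sum.cong refl) (auto simp: orthonormal_def)
  also have "\<dots> = spectral_sum d Q (\<lambda>c. f c * g c) a b"
    by (simp add: spectral_sum_def sum.delta if_distrib[of "\<lambda>x. _ * x"] algebra_simps cong: if_cong)
  finally show ?thesis .
qed

lemma mtrace_spectral_sum: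
  assumes Q: "orthonormal d Q"
  shows "mtrace d (spectral_sum d Q g) = (\<Sum>c<d. g c)"
proof -
  have "mtrace d (spectral_sum d Q g) = (\<Sum>c<d. \<Sum>a<d. g c * (Q a c * Q a c))"
    unfolding mtrace_def spectral_sum_def by (subst sum.swap) (simp add: algebra_simps)
  also have "\<dots> = (\<Sum>c<d. g c * 1)"
    unfolding sum_distrib_left[symmetric] using Q by (intro sum.cong refl) (auto simp: orthonormal_def)
  finally show ?thesis by simp
qed

lemma qform_spectral_sum: "qform d (spectral_sum d Q g) v = (\<Sum>c<d. g c * (\<Sum>a<d. v a * Q a c)\<^sup>2)"
proof -
  have "qform d (spectral_sum d Q g) v = (\<Sum>a<d. \<Sum>b<d. \<Sum>c<d. g c * ((v a * Q a c) * (v b * Q b c)))"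
    by (simp add: qform_def spectral_sum_def sum_distrib_left sum_distrib_right algebra_simps)
  also have "\<dots> = (\<Sum>a<d. \<Sum>c<d. \<Sum>b<d. g c * ((v a * Q a c) * (v b * Q b c)))"
    by (intro sum.cong refl sum.swap)
  also have "\<dots> = (\<Sum>c<d. \<Sum>a<d. \<Sum>b<d. g c * ((v a * Q a c) * (v b * Q b c)))"
    by (rule sum.swap)
  finally show ?thesis
    by (simp add: power2_eq_square sum_product) (simp add: sum_distrib_left sum_distrib_right)
qed

lemma psd_spectral_sum: "(\<And>c. c < d \<Longrightarrow> 0 \<le> g c) \<Longrightarrow> psd d (spectral_sum d Q g)"
  unfolding psd_def qform_spectral_sum by (auto intro!: sum_nonneg simp: spectral_sum_def mult_ac)

text \<open>In the common eigenbasis the relation reduces to \<open>k - g = x * (k * g)\<close> for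
  \<open>k = g / (1 - x * g)\<close>.\<close>

lemma shifted_spectral_sum:
  assumes Q: "orthonormal d Q" and g: "\<And>c. c < d \<Longrightarrow> x * g c \<noteq> 1"
  shows "shifted d x (spectral_sum d Q (\<lambda>c. g c / (1 - x * g c))) (spectral_sum d Q g)"
proof -
  have "g c / (1 - x * g c) * p - g c * p = x * (g c / (1 - x * g c) * g c * p)" if "c < d" for c p
    using g[OF that] by (simp add: field_simps)
  then show ?thesis
    unfolding shifted_def mprod_spectral_sum[OF Q]
    by (auto simp: spectral_sum_def sum_subtractf[symmetric] sum_distrib_left mult.assoc intro!: sum.cong)
qed

section \<open>The greedy barrier argument\<close>

text \<open>Chebyshev's sum inequality with weights \<open>g\<close> for \<open>k\<close> and
  \<open>1 / (1 - x * g)\<close>, which both increase with \<open>g\<close>; \<open>k\<close> is the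
  weight times the latter.\<close>

lemma chebyshev_shift:
  fixes g :: "nat \<Rightarrow> real"
  assumes g: "\<And>c. c < d \<Longrightarrow> 0 \<le> g c" and x: "0 \<le> x" "\<And>c. c < d \<Longrightarrow> x * g c < 1"
  defines "k \<equiv> \<lambda>c. g c / (1 - x * g c)"
  shows "(\<Sum>c<d. k c * g c) * (\<Sum>c<d. k c) \<le> (\<Sum>c<d. g c) * (\<Sum>c<d. k c * k c)"
proof -
  \<comment> \<open>This is \<open>g i * g j\<close> times the product of the increments of the two
    functions, in a form that admits zero eigenvalues.\<close>
  have pair: "0 \<le> (k i - k j) * (g j * k i - g i * k j)" if "i < d" "j < d" for i j
  proof -
    have i: "1 - x * g i > 0" and j: "1 - x * g j > 0" using x(2) that by force+
    have 1: "k i - k j = (g i - g j) / ((1 - x * g i) * (1 - x * g j))"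
      using i j unfolding k_def by (simp add: divide_simps) (simp add: algebra_simps)
    have 2: "g j * k i - g i * k j = x * g i * g j * (g i - g j) / ((1 - x * g i) * (1 - x * g j))"
      using i j unfolding k_def by (simp add: divide_simps) (simp add: algebra_simps)
    have "(k i - k j) * (g j * k i - g i * k j) =
       x * g i * g j * ((g i - g j) / ((1 - x * g i) * (1 - x * g j)))\<^sup>2"
      unfolding 1 2 by (simp add: power2_eq_square)
    then show ?thesis using g that x(1) by simp
  qed
  \<comment> \<open>Summed over all pairs, these terms give twice the difference of the two
    sides.\<close>
  have "0 \<le> (\<Sum>i<d. \<Sum>j<d. (k i - k j) * (g j * k i - g i * k j))"
    using pair by (intro sum_nonneg) auto
  also have "\<dots> = (\<Sum>i<d. \<Sum>j<d. g j * (k i * k i)) - (\<Sum>i<d. \<Sum>j<d. (k i * g i) * k j)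
     - (\<Sum>i<d. \<Sum>j<d. k i * (k j * g j)) + (\<Sum>i<d. \<Sum>j<d. g i * (k j * k j))"
    unfolding sum_subtractf[symmetric] sum.distrib[symmetric]
    by (intro sum.cong refl) (simp add: algebra_simps)
  also have "\<dots> = 2 * ((\<Sum>c<d. g c) * (\<Sum>c<d. k c * k c) - (\<Sum>c<d. k c * g c) * (\<Sum>c<d. k c))"
  proof -
    have "(\<Sum>i<d. \<Sum>j<d. g j * (k i * k i)) = (\<Sum>c<d. g c) * (\<Sum>c<d. k c * k c)"
      by (subst sum.swap) (simp only: sum_product)
    moreover have "(\<Sum>i<d. \<Sum>j<d. k i * (k j * g j)) = (\<Sum>c<d. k c * g c) * (\<Sum>c<d. k c)"
      by (simp only: sum_product[symmetric] mult.commute)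
    ultimately show ?thesis by (simp only: sum_product[symmetric]) simp
  qed
  finally show ?thesis by simp
qed

text \<open>Eliminating \<open>i\<close> lowers the trace by \<open>r i / K i i\<close>. If this
  were always below the claimed mean, multiplying by the weights \<open>K i i\<close> and summing
  would give tr K^2 * tr K < tr K * tr K^2. A zero weight comes with a zero row.\<close>

lemma exists_schur_mtrace_le:
  assumes K: "psd d K" and pos: "mtrace d K > 0"
  shows "\<exists>i<d. K i i > 0 \<and> mtrace d (schur i K) \<le> mtrace d K - mtrace d (mprod d K K) / mtrace d K"
proof (rule ccontr)
  assume neg: "\<not> ?thesis"
  define r where "r = (\<lambda>i. \<Sum>a<d. K a i * K i a)"
  have trs: "mtrace d (schur i K) = mtrace d K - r i / K i i" for i
    by (simp add: mtrace_def schur_def r_def sum_subtractf sum_divide_distrib)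
  have sum_r: "(\<Sum>i<d. r i) = mtrace d (mprod d K K)"
    by (simp add: r_def mtrace_def mprod_def mult.commute)
  have less: "r i * mtrace d K < K i i * mtrace d (mprod d K K)" if "i < d" "K i i > 0" for i
  proof -
    have "mtrace d (mprod d K K) / mtrace d K > r i / K i i" using neg that unfolding trs by fastforce
    then show ?thesis using that pos by (simp add: field_simps)
  qed
  have le: "r i * mtrace d K \<le> K i i * mtrace d (mprod d K K)" if i: "i < d" for i
  proof (cases "K i i = 0")
    case True
    then have "r i = 0"
      unfolding r_def using psd_diag_zero[OF K i] by (intro sum.neutral) auto
    with True show ?thesis by simp
  next
    case False
    with less[OF i] psd_diag_nonneg[OF K i] show ?thesis by simp
  qed
  \<comment> \<open>One positive weight makes the summed inequality strict.\<close>
  obtain i where i: "i < d" "K i i > 0"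
  proof (rule ccontr)
    assume "\<not> thesis"
    then have "\<And>i. i < d \<Longrightarrow> K i i \<le> 0" using that by (meson not_le)
    then have "mtrace d K \<le> 0" unfolding mtrace_def by (intro sum_nonpos) auto
    with pos show False by simp
  qed
  have "(\<Sum>i<d. r i * mtrace d K) < (\<Sum>i<d. K i i * mtrace d (mprod d K K))"
    using i less by (intro sum_strict_mono_ex1) (auto intro: le)
  then have "mtrace d (mprod d K K) * mtrace d K < mtrace d K * mtrace d (mprod d K K)"
    unfolding sum_distrib_right[symmetric] sum_r by (simp add: mtrace_def)
  then show False by simp
qed

lemma sum_nonneg_member_le:
  fixes g :: "nat \<Rightarrow> real"
  assumes "\<And>c. c < d \<Longrightarrow> 0 \<le> g c" "c < d"
  shows "g c \<le> (\<Sum>c<d. g c)"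
  using assms by (intro member_le_sum) auto

text \<open>The move costs tr K minus the old trace, which equals \<open>x\<close> times the sum of
  \<open>k c * g c\<close>; the elimination gains at least tr K^2 / tr K. The gain covers the
  cost.\<close>

lemma shift_schur_step:
  assumes Q: "orthonormal d Q" and g: "\<And>c. c < d \<Longrightarrow> 0 \<le> g c"
    and pos: "0 < (\<Sum>c<d. g c)" and x: "0 \<le> x" "x * (\<Sum>c<d. g c) < 1"
  defines "K \<equiv> spectral_sum d Q (\<lambda>c. g c / (1 - x * g c))"
  shows "psd d K" "shifted d x K (spectral_sum d Q g)"
    "\<exists>i<d. K i i > 0 \<and> mtrace d (schur i K) \<le> (\<Sum>c<d. g c)"
proof -
  define k where "k = (\<lambda>c. g c / (1 - x * g c))"
  have xg: "x * g c < 1" if "c < d" for c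
    using mult_left_mono[OF sum_nonneg_member_le[of d g, OF g that] x(1)] x(2) by linarith
  have k: "g c \<le> k c" if "c < d" for c
  proof -
    have "g c * (1 - x * g c) \<le> g c * 1" using g[OF that] x(1) by (intro mult_left_mono) auto
    then show ?thesis using xg[OF that] by (simp add: k_def le_divide_eq)
  qed
  have k0: "0 \<le> k c" if "c < d" for c using k[OF that] g[OF that] by linarith
  show psd: "psd d K" unfolding K_def using k0 by (intro psd_spectral_sum) (simp add: k_def)
  show "shifted d x K (spectral_sum d Q g)"
    unfolding K_def using xg by (intro shifted_spectral_sum Q) force
  have trK: "mtrace d K = (\<Sum>c<d. k c)" by (simp add: K_def mtrace_spectral_sum[OF Q] k_def)
  have trKK: "mtrace d (mprod d K K) = (\<Sum>c<d. k c * k c)"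
  proof -
    have "mprod d K K = spectral_sum d Q (\<lambda>c. k c * k c)" by (intro ext) (simp add: K_def mprod_spectral_sum[OF Q] k_def)
    then show ?thesis by (simp add: mtrace_spectral_sum[OF Q])
  qed
  have "(\<Sum>c<d. g c) \<le> (\<Sum>c<d. k c)" using k by (intro sum_mono) auto
  then have trpos: "0 < mtrace d K" using pos by (simp add: trK)
  have "mtrace d K - (\<Sum>c<d. g c) = x * (\<Sum>c<d. k c * g c)"
    unfolding trK sum_subtractf[symmetric] sum_distrib_left
  proof (intro sum.cong refl)
    fix c assume "c \<in> {..<d}"
    then have "1 - x * g c \<noteq> 0" using xg[of c] by simp
    then show "k c - g c = x * (k c * g c)" unfolding k_def by (simp add: divide_simps) (simp add: algebra_simps)
  qed
  then have "(\<Sum>c<d. g c) * ((mtrace d K - (\<Sum>c<d. g c)) * mtrace d K)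
      = x * (\<Sum>c<d. g c) * ((\<Sum>c<d. k c * g c) * (\<Sum>c<d. k c))"
    by (simp add: trK)
  \<comment> \<open>Here the move has to be shorter than the reciprocal of the old trace;
    Chebyshev's inequality does the rest.\<close>
  also have "\<dots> \<le> 1 * ((\<Sum>c<d. k c * g c) * (\<Sum>c<d. k c))"
    using x(2) k0 g by (intro mult_right_mono mult_nonneg_nonneg sum_nonneg) auto
  also have "\<dots> \<le> (\<Sum>c<d. g c) * mtrace d (mprod d K K)"
    using chebyshev_shift[of d g x, OF g x(1) xg] by (simp add: trKK k_def)
  finally have "(mtrace d K - (\<Sum>c<d. g c)) * mtrace d K \<le> mtrace d (mprod d K K)"
    using pos by simp
  then have "mtrace d K - mtrace d (mprod d K K) / mtrace d K \<le> (\<Sum>c<d. g c)"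
    using trpos by (simp add: field_simps)
  with exists_schur_mtrace_le[OF psd trpos]
  show "\<exists>i<d. K i i > 0 \<and> mtrace d (schur i K) \<le> (\<Sum>c<d. g c)"
    using order_trans by blast
qed

text \<open>For \<open>M = A\<^sup>T A\<close>, \<open>N\<close> is the Gram matrix of the residual \<open>A - A W\<close> of the orthogonal
  projection onto the span of the columns in \<open>S\<close>; the last but one clause says that these columns
  are linearly independent.\<close>

definition eliminated ::
  "nat \<Rightarrow> (nat \<Rightarrow> nat \<Rightarrow> real) \<Rightarrow> nat set \<Rightarrow> (nat \<Rightarrow> nat \<Rightarrow> real) \<Rightarrow> bool" where
  "eliminated d M S N \<longleftrightarrow> S \<subseteq> {..<d} \<and> psd d N \<and>
    (\<exists>W. (\<forall>a b. a \<notin> S \<longrightarrow> W a b = 0) \<and> (\<forall>a<d. \<forall>b<d. N a b = M a b - mprod d M W a b)) \<and>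
    (\<forall>a\<in>S. \<forall>b<d. N a b = 0) \<and>
    (\<forall>v. (\<forall>a. a \<notin> S \<longrightarrow> v a = 0) \<longrightarrow> (\<forall>a<d. (\<Sum>b<d. M a b * v b) = 0) \<longrightarrow> (\<forall>a. v a = 0)) \<and>
    (\<forall>v. qform d N v \<le> qform d M v)"

lemma eliminated_indep:
  assumes "eliminated d M S N" and "\<forall>a. a \<notin> S \<longrightarrow> v a = 0"
    and "\<forall>a<d. (\<Sum>b<d. M a b * v b) = 0"
  shows "v a = 0"
  using assms by (simp add: eliminated_def)

lemma eliminated_coeffs:
  assumes "eliminated d M S N"
  shows "\<exists>W. (\<forall>a b. a \<notin> S \<longrightarrow> W a b = 0) \<and> (\<forall>a<d. \<forall>b<d. N a b = M a b - mprod d M W a b)"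
  using assms by (simp add: eliminated_def)

lemma eliminated_empty: "psd d M \<Longrightarrow> eliminated d M {} M"
  by (auto simp: eliminated_def mprod_def intro!: exI[of _ "\<lambda>_ _. 0"])

text \<open>A Gram-Schmidt step: all residual columns are made orthogonal to the residual of column
  \<open>i\<close>.\<close>

lemma eliminated_insert:
  assumes M: "psd d M" and e: "eliminated d M S N" and i: "i < d" and pos: "N i i > 0"
  shows "eliminated d M (insert i S) (schur i N)" "i \<notin> S"
proof -
  have S: "S \<subseteq> {..<d}" and N: "psd d N" and rows: "\<And>a b. a \<in> S \<Longrightarrow> b < d \<Longrightarrow> N a b = 0"
    and le: "\<And>v. qform d N v \<le> qform d M v"
    using e by (simp_all add: eliminated_def)
  have indep: "v a = 0" if "\<And>a. a \<notin> S \<Longrightarrow> v a = 0" "\<And>a. a < d \<Longrightarrow> (\<Sum>b<d. M a b * v b) = 0"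
    for v a
    using eliminated_indep[OF e, of v] that by blast
  obtain W where W0: "\<And>a b. a \<notin> S \<Longrightarrow> W a b = 0"
    and W: "\<And>a b. a < d \<Longrightarrow> b < d \<Longrightarrow> N a b = M a b - mprod d M W a b"
    using eliminated_coeffs[OF e] by metis
  show iS: "i \<notin> S" using rows[of i i] i pos by auto
  \<comment> \<open>\<open>u\<close> expresses the residual of column \<open>i\<close> in the
    original columns, so \<open>M u\<close> is column \<open>i\<close> of \<open>N\<close>.
    \<open>W'\<close> adds the multiple of \<open>u\<close> that projects each column onto that
    residual.\<close>
  define u where "u = (\<lambda>a. (if a = i then 1 else 0) - W a i)"
  define W' where "W' = (\<lambda>a b. W a b + u a * (N i b / N i i))"
  have W'0: "W' a b = 0" if "a \<notin> insert i S" for a b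
    using that W0 by (simp add: W'_def u_def)
  have Mu: "(\<Sum>c<d. M a c * u c) = N a i" if "a < d" for a
    using W[OF that i] i
    by (simp add: u_def right_diff_distrib sum_subtractf mprod_def if_distrib[of "\<lambda>x. _ * x"] cong: if_cong)
  have W': "schur i N a b = M a b - mprod d M W' a b" if "a < d" "b < d" for a b
  proof -
    have "mprod d M W' a b = mprod d M W a b + (\<Sum>c<d. M a c * u c) * (N i b / N i i)"
      unfolding mprod_def W'_def sum_distrib_right sum.distrib[symmetric]
      by (intro sum.cong refl) (simp add: algebra_simps)
    then show ?thesis using W[OF that] Mu[OF that(1)] by (simp add: schur_def)
  qed
  have rows': "schur i N a b = 0" if "a \<in> insert i S" "b < d" for a b
    using that rows i pos by (auto simp: schur_def)
  \<comment> \<open>Row \<open>i\<close> of \<open>N\<close> is u^T M and so annihilates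
    \<open>v\<close>. It vanishes on \<open>S\<close>, which leaves only \<open>N i i * v i\<close>;
    hence \<open>v i = 0\<close> and \<open>v\<close> is supported on \<open>S\<close>.\<close>
  have indep': "v a = 0" if v: "\<And>a. a \<notin> insert i S \<Longrightarrow> v a = 0"
    "\<And>a. a < d \<Longrightarrow> (\<Sum>b<d. M a b * v b) = 0" for v a
  proof -
    have "(\<Sum>b<d. N i b * v b) = (\<Sum>b<d. N b i * v b)"
      by (intro sum.cong refl) (metis psd_sym[OF N] i lessThan_iff)
    also have "\<dots> = (\<Sum>b<d. (\<Sum>c<d. M b c * u c) * v b)"
      using Mu by (intro sum.cong) auto
    also have "\<dots> = (\<Sum>b<d. \<Sum>c<d. u c * (M c b * v b))"
      unfolding sum_distrib_right using psd_sym[OF M] by (intro sum.cong) (auto simp: mult_ac)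
    also have "\<dots> = (\<Sum>c<d. u c * (\<Sum>b<d. M c b * v b))"
      by (subst sum.swap) (simp add: sum_distrib_left)
    also have "\<dots> = 0" using v(2) by (intro sum.neutral) auto
    finally have "(\<Sum>b<d. N i b * v b) = 0" .
    moreover have "(\<Sum>b<d. N i b * v b) = (\<Sum>b<d. if b = i then N i i * v i else 0)"
    proof (intro sum.cong refl)
      fix b assume b: "b \<in> {..<d}"
      show "N i b * v b = (if b = i then N i i * v i else 0)"
      proof (cases "b \<in> S")
        case True
        then have "N i b = 0" using rows[OF True i] psd_sym[OF N i, of b] b by simp
        with True iS show ?thesis by auto
      qed (use v(1) in auto)
    qed
    ultimately have "N i i * v i = 0" using i by simp
    then have "v i = 0" using pos by simp
    then have "v a = 0" if "a \<notin> S" for a using v(1)[of a] that by (cases "a = i") auto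
    then show ?thesis using v(2) by (rule indep)
  qed
  have le': "qform d (schur i N) v \<le> qform d M v" for v
  proof -
    have "0 \<le> (\<Sum>b<d. N i b * v b)\<^sup>2 / N i i" using pos by simp
    then show ?thesis using qform_schur[of d N i v, OF psd_sym[OF N] i] le[of v] by linarith
  qed
  show "eliminated d M (insert i S) (schur i N)"
    unfolding eliminated_def
  proof (intro conjI)
    show "insert i S \<subseteq> {..<d}" using S i by simp
    show "psd d (schur i N)" by (rule psd_schur[OF N i pos])
    show "\<exists>W. (\<forall>a b. a \<notin> insert i S \<longrightarrow> W a b = 0) \<and>
        (\<forall>a<d. \<forall>b<d. schur i N a b = M a b - mprod d M W a b)"
      by (rule exI[of _ W'], intro conjI allI impI, rule W'0, assumption, rule W', assumption+)
    show "\<forall>a\<in>insert i S. \<forall>b<d. schur i N a b = 0" by (intro ballI allI impI, rule rows')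
    show "\<forall>v. qform d (schur i N) v \<le> qform d M v" by (intro allI le')
    show "\<forall>v. (\<forall>a. a \<notin> insert i S \<longrightarrow> v a = 0) \<longrightarrow>
        (\<forall>a<d. (\<Sum>b<d. M a b * v b) = 0) \<longrightarrow> (\<forall>a. v a = 0)"
    proof (intro allI impI)
      fix v :: "nat \<Rightarrow> real" and a
      assume *: "\<forall>a. a \<notin> insert i S \<longrightarrow> v a = 0" "\<forall>a<d. (\<Sum>b<d. M a b * v b) = 0"
      show "v a = 0" by (rule indep'[of v a]) (use * in simp_all)
    qed
  qed
qed

text \<open>Each round moves the barrier by \<open>x\<close> and eliminates one column while the
  trace stays at most \<open>\<phi>\<close>. Eigenbases and the nonvanishing of \<open>N\<close>
  below rank \<open>t\<close> enter as hypotheses, to be discharged afterwards.\<close>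

lemma greedy_elimination:
  assumes spectral: "\<And>f. psd d f \<Longrightarrow>
      \<exists>Q g. orthonormal d Q \<and> (\<forall>c<d. 0 \<le> g c) \<and> (\<forall>a<d. \<forall>b<d. f a b = spectral_sum d Q g a b)"
    and M: "psd d M"
    and G: "psd d G0" "shifted d y G0 M" "mtrace d G0 \<le> \<phi>"
    and x: "0 \<le> x" "x * \<phi> < 1"
    and nz: "\<And>S N. eliminated d M S N \<Longrightarrow> card S < t \<Longrightarrow> \<exists>a<d. \<exists>b<d. N a b \<noteq> 0"
  shows "j \<le> t \<Longrightarrow> \<exists>S N G. eliminated d M S N \<and> card S = j \<and> psd d G \<and>
    shifted d (y + real j * x) G N \<and> mtrace d G \<le> \<phi>"
proof (induction j)
  case 0
  show ?case using eliminated_empty[OF M] G by (intro exI[of _ "{}"] exI[of _ M] exI[of _ G0]) auto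
next
  case (Suc j)
  then obtain S N G where e: "eliminated d M S N" and c: "card S = j" and G: "psd d G"
    and s: "shifted d (y + real j * x) G N" and mtrace: "mtrace d G \<le> \<phi>" by auto
  have N: "psd d N" using e by (simp add: eliminated_def)
  obtain Q g where Qg: "orthonormal d Q \<and> (\<forall>c<d. 0 \<le> g c) \<and>
      (\<forall>a<d. \<forall>b<d. G a b = spectral_sum d Q g a b)"
    using spectral[OF G] by blast
  then have Q: "orthonormal d Q" and g: "\<And>c. c < d \<Longrightarrow> 0 \<le> g c"
    and Gg: "\<And>a b. a < d \<Longrightarrow> b < d \<Longrightarrow> G a b = spectral_sum d Q g a b"
    by auto
  have trG: "mtrace d G = (\<Sum>c<d. g c)"
    using mtrace_spectral_sum[OF Q, of g] Gg by (simp add: mtrace_def)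
  \<comment> \<open>A zero trace would force G = 0, and then N = 0 by the shift relation.\<close>
  have "mtrace d G \<noteq> 0"
  proof
    assume "mtrace d G = 0"
    then have z: "\<And>a b. a < d \<Longrightarrow> b < d \<Longrightarrow> G a b = 0" using psd_mtrace_zero[OF G] by blast
    have "N a b = 0" if "a < d" "b < d" for a b
      using shiftedD[OF s that] z[OF that] z that(1) by (simp add: mprod_def)
    then show False using nz[OF e] c Suc.prems by auto
  qed
  then have pos: "0 < (\<Sum>c<d. g c)" using psd_mtrace_nonneg[OF G] trG by simp
  have small: "x * (\<Sum>c<d. g c) < 1"
    using mult_left_mono[OF mtrace x(1)] x(2) by (simp add: trG)
  define K where "K = spectral_sum d Q (\<lambda>c. g c / (1 - x * g c))"
  have K: "psd d K" and sK: "shifted d x K (spectral_sum d Q g)"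
    using shift_schur_step(1,2)[of d Q g x, OF Q g pos x(1) small] by (simp_all add: K_def)
  obtain i where i: "i < d" and Ki: "K i i > 0" and tri: "mtrace d (schur i K) \<le> (\<Sum>c<d. g c)"
    using shift_schur_step(3)[of d Q g x, OF Q g pos x(1) small] by (auto simp: K_def)
  have "shifted d x K G"
    using sK Gg by (simp add: shifted_def mprod_def)
  from shifted_trans[OF s this] have KN: "shifted d (y + real j * x + x) K N" .
  \<comment> \<open>The pivot of \<open>N\<close> is positive too: otherwise column \<open>i\<close>
    of \<open>N\<close> vanishes, and K = N + z K N, with \<open>z\<close> the accumulated shift,
    gives \<open>K i i = 0\<close>.\<close>
  have Ni: "N i i > 0"
  proof (rule ccontr)
    assume "\<not> N i i > 0"
    then have "N i i = 0" using psd_diag_nonneg[OF N i] by simp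
    then have "N a i = 0" if "a < d" for a
      using psd_diag_zero[OF N i _ that] psd_sym[OF N that i] by simp
    then have "K i i = 0" using shiftedD[OF KN i i] i by (simp add: mprod_def)
    with Ki show False by simp
  qed
  have "shifted d (y + real (Suc j) * x) (schur i K) (schur i N)"
    using shifted_schur[OF KN i] Ki Ni by (simp add: algebra_simps)
  moreover have "card (insert i S) = Suc j"
    using eliminated_insert(2)[OF M e i Ni] c e finite_subset[of S "{..<d}"]
    by (auto simp: eliminated_def)
  moreover have "mtrace d (schur i K) \<le> \<phi>" using tri mtrace trG by simp
  ultimately show ?case
    using eliminated_insert(1)[OF M e i Ni] psd_schur[OF K i Ki]
    by (intro exI[of _ "insert i S"] exI[of _ "schur i N"] exI[of _ "schur i K"] conjI)
qed

section \<open>Spectral decomposition of real symmetric matrices\<close>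

text \<open>The fundamental theorem of algebra yields a complex eigenvector; symmetry makes the
  eigenvalue real, so the real and imaginary parts satisfy the eigenvalue equation
  separately.\<close>

lemma real_symmetric_eigenvector:
  fixes f :: "nat \<Rightarrow> nat \<Rightarrow> real"
  assumes sym: "\<And>a b. a < d \<Longrightarrow> b < d \<Longrightarrow> f a b = f b a" and d: "0 < d"
  shows "\<exists>v e. (\<forall>a<d. (\<Sum>b<d. f a b * v b) = e * v a) \<and> (\<Sum>a<d. (v a)\<^sup>2) = 1"
proof -
  define C where "C = mat d d (\<lambda>(a, b). complex_of_real (f a b))"
  have C: "C \<in> carrier_mat d d" by (simp add: C_def)
  have "degree (char_poly C) = d" using degree_monic_char_poly[OF C] by simp
  then obtain z where "poly (char_poly C) z = 0"
    using d fundamental_theorem_of_algebra[of "char_poly C"] constant_degree[of "char_poly C"] by auto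
  then have "eigenvalue C z" using eigenvalue_root_char_poly[OF C] by simp
  then obtain w where w: "w \<in> carrier_vec d" "w \<noteq> 0\<^sub>v d" and Cw: "C *\<^sub>v w = z \<cdot>\<^sub>v w"
    using C by (auto simp: eigenvalue_def eigenvector_def)
  define x y where "x = (\<lambda>a. Re (w $ a))" and "y = (\<lambda>a. Im (w $ a))"
  have ev: "(\<Sum>b<d. complex_of_real (f a b) * w $ b) = z * w $ a" if "a < d" for a
  proof -
    have "(C *\<^sub>v w) $ a = (\<Sum>b<d. complex_of_real (f a b) * w $ b)"
      using that w(1) by (auto simp: C_def scalar_prod_def atLeast0LessThan intro!: sum.cong)
    then show ?thesis using that w(1) by (simp add: Cw)
  qed
  have fx: "(\<Sum>b<d. f a b * x b) = Re z * x a - Im z * y a"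
    and fy: "(\<Sum>b<d. f a b * y b) = Re z * y a + Im z * x a" if "a < d" for a
    using arg_cong[OF ev[OF that], of Re] arg_cong[OF ev[OF that], of Im]
    by (simp_all add: x_def y_def)
  have nonzero: "\<exists>a<d. w $ a \<noteq> 0"
  proof (rule ccontr)
    assume "\<not> ?thesis"
    then have "w = 0\<^sub>v d" using w(1) by (intro eq_vecI) auto
    with w(2) show False by simp
  qed
  \<comment> \<open>Evaluating the bilinear form at \<open>x\<close> and \<open>y\<close> from
    either side shows that \<open>Im z\<close> times the squared length of \<open>w\<close> is
    zero.\<close>
  have "(\<Sum>a<d. x a * (\<Sum>b<d. f a b * y b)) = (\<Sum>a<d. \<Sum>b<d. x a * f a b * y b)"
    by (simp add: sum_distrib_left mult.assoc)
  also have "\<dots> = (\<Sum>b<d. \<Sum>a<d. x a * f a b * y b)" by (rule sum.swap)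
  also have "\<dots> = (\<Sum>b<d. y b * (\<Sum>a<d. f b a * x a))"
    unfolding sum_distrib_left using sym by (intro sum.cong refl) (simp add: mult_ac)
  finally have "(\<Sum>a<d. x a * (Re z * y a + Im z * x a)) = (\<Sum>b<d. y b * (Re z * x b - Im z * y b))"
    by (simp add: fx fy)
  then have "(\<Sum>a<d. Im z * ((x a)\<^sup>2 + (y a)\<^sup>2)) = 0"
    unfolding eq_iff_diff_eq_0[of "sum _ _" "sum _ _"] sum_subtractf[symmetric]
    by (simp add: power2_eq_square algebra_simps)
  then have Im: "Im z * (\<Sum>a<d. (x a)\<^sup>2 + (y a)\<^sup>2) = 0" by (simp only: sum_distrib_left)
  obtain a0 where a0: "a0 < d" "w $ a0 \<noteq> 0" using nonzero by blast
  have "(x a0)\<^sup>2 + (y a0)\<^sup>2 > 0"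
    using a0(2) by (auto simp: x_def y_def complex_eq_iff sum_power2_gt_zero_iff)
  also have "(x a0)\<^sup>2 + (y a0)\<^sup>2 \<le> (\<Sum>a<d. (x a)\<^sup>2 + (y a)\<^sup>2)"
    using a0(1) by (intro member_le_sum) auto
  finally have Im0: "Im z = 0" using Im by simp
  \<comment> \<open>Whichever of the two parts is nonzero at \<open>a0\<close>.\<close>
  define u where "u = (if x a0 \<noteq> 0 then x else y)"
  have u: "u a0 \<noteq> 0" using a0(2) by (auto simp: u_def x_def y_def complex_eq_iff)
  have fu: "(\<Sum>b<d. f a b * u b) = Re z * u a" if "a < d" for a
    using fx[OF that] fy[OF that] Im0 by (simp add: u_def)
  define s where "s = (\<Sum>a<d. (u a)\<^sup>2)"
  have "0 < (u a0)\<^sup>2" using u by simp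
  also have "\<dots> \<le> s" unfolding s_def using a0(1) by (intro member_le_sum) auto
  finally have s: "s > 0" .
  define v where "v = (\<lambda>a. u a / sqrt s)"
  have "(\<Sum>b<d. f a b * v b) = Re z * v a" if "a < d" for a
    using fu[OF that] by (simp add: v_def sum_divide_distrib[symmetric])
  moreover have "(\<Sum>a<d. (v a)\<^sup>2) = 1"
    using s by (simp add: v_def power_divide sum_divide_distrib[symmetric] s_def[symmetric])
  ultimately show ?thesis by blast
qed

definition ident :: "nat \<Rightarrow> nat \<Rightarrow> real" where
  "ident a b = (if a = b then 1 else 0)"

lemma sum_ident [simp]:
  "b < d \<Longrightarrow> (\<Sum>c<d. h c * ident c b) = h b" "b < d \<Longrightarrow> (\<Sum>c<d. h c * ident b c) = h b"
  "b < d \<Longrightarrow> (\<Sum>c<d. ident c b * h c) = h b" "b < d \<Longrightarrow> (\<Sum>c<d. ident b c * h c) = h b"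
  by (simp_all add: ident_def if_distrib[of "\<lambda>x. _ * x"] if_distrib[of "\<lambda>x. x * _"] cong: if_cong)

lemma ident_commute: "ident a b = ident b a"
  by (simp add: ident_def)

lemma orthonormal_alt: "orthonormal d Q \<longleftrightarrow> (\<forall>a<d. \<forall>b<d. (\<Sum>c<d. Q c a * Q c b) = ident a b)"
  by (simp add: orthonormal_def ident_def)

text \<open>\<open>H\<close> is the Householder reflection along \<open>v - e\<^sub>d\<close>; if this vector vanishes then \<open>s = 0\<close>, and
  \<open>2 / s = 0\<close> makes \<open>H\<close> the identity.\<close>

lemma householder_exists:
  assumes v: "(\<Sum>a<Suc d. (v a)\<^sup>2) = 1"
  shows "\<exists>H. (\<forall>a b. H a b = H b a) \<and> orthonormal (Suc d) H \<and> (\<forall>a<Suc d. H a d = v a)"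
proof -
  define w where "w = (\<lambda>a. v a - ident a d)"
  define s where "s = (\<Sum>a<Suc d. w a * w a)"
  define H where "H = (\<lambda>a b. ident a b - 2 / s * w a * w b)"
  have s: "s = 2 - 2 * v d"
  proof -
    have "s = (\<Sum>a<Suc d. (v a)\<^sup>2 - 2 * (v a * ident a d) + ident a d * ident a d)"
      unfolding s_def w_def by (intro sum.cong refl) (simp add: power2_eq_square algebra_simps)
    also have "\<dots> = (\<Sum>a<Suc d. (v a)\<^sup>2) - 2 * (\<Sum>a<Suc d. v a * ident a d) + (\<Sum>a<Suc d. ident a d * ident a d)"
      by (simp only: sum.distrib sum_subtractf sum_distrib_left)
    also have "\<dots> = 2 - 2 * v d" unfolding v by (simp only: sum_ident lessI) (simp add: ident_def)
    finally show ?thesis .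
  qed
  have sym: "H a b = H b a" for a b by (simp add: H_def ident_def)
  have orth: "(\<Sum>c<Suc d. H c a * H c b) = ident a b" if a: "a < Suc d" and b: "b < Suc d" for a b
  proof -
    have "(\<Sum>c<Suc d. H c a * H c b) = (\<Sum>c<Suc d. ident c a * ident c b - 2 / s * w b * (ident c a * w c)
      - 2 / s * w a * (ident c b * w c) + (2 / s * w a) * (2 / s * w b) * (w c * w c))"
      unfolding H_def by (intro sum.cong refl) (simp add: algebra_simps)
    also have "\<dots> = ident a b - 2 / s * w b * w a - 2 / s * w a * w b + (2 / s * w a) * (2 / s * w b) * s"
      unfolding sum.distrib sum_subtractf sum_distrib_left[symmetric] s_def[symmetric]
      using a b by (simp only: sum_ident ident_commute[of b a])
    also have "\<dots> = ident a b" by (cases "s = 0") (simp_all add: field_simps)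
    finally show ?thesis .
  qed
  have last: "H a d = v a" if "a < Suc d" for a
  proof (cases "s = 0")
    case True
    then have "\<forall>a\<in>{..<Suc d}. w a * w a = 0"
      unfolding s_def by (subst (asm) sum_nonneg_eq_0_iff) auto
    then have "w a = 0" using that by auto
    then show ?thesis by (simp add: H_def w_def True)
  next
    case False
    have "w d = - s / 2" using s by (simp add: w_def ident_def)
    then have "H a d = ident a d + w a" using False by (simp add: H_def)
    then show ?thesis by (simp add: w_def)
  qed
  show ?thesis using sym orth last by (intro exI[of _ H]) (simp add: orthonormal_alt del: sum.lessThan_Suc)
qed

lemma orthonormal_mprod:
  assumes H: "orthonormal d H" and Q: "orthonormal d Q"
  shows "orthonormal d (mprod d H Q)"
  unfolding orthonormal_alt
proof (intro allI impI)
  fix a b assume ab: "a < d" "b < d"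
  have "(\<Sum>c<d. mprod d H Q c a * mprod d H Q c b) = (\<Sum>c<d. \<Sum>p<d. \<Sum>q<d. Q p a * Q q b * (H c p * H c q))"
    by (simp add: mprod_def sum_product mult_ac)
  also have "\<dots> = (\<Sum>p<d. \<Sum>c<d. \<Sum>q<d. Q p a * Q q b * (H c p * H c q))" by (rule sum.swap)
  also have "\<dots> = (\<Sum>p<d. \<Sum>q<d. \<Sum>c<d. Q p a * Q q b * (H c p * H c q))"
    by (intro sum.cong refl sum.swap)
  also have "\<dots> = (\<Sum>p<d. \<Sum>q<d. Q p a * Q q b * ident p q)"
    unfolding sum_distrib_left[symmetric] using H by (intro sum.cong refl) (auto simp: orthonormal_alt)
  also have "\<dots> = (\<Sum>p<d. Q p a * Q p b)"
    by (intro sum.cong refl) simp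
  also have "\<dots> = ident a b" using Q ab by (simp add: orthonormal_alt)
  finally show "(\<Sum>c<d. mprod d H Q c a * mprod d H Q c b) = ident a b" .
qed

text \<open>Conjugation by an arbitrary \<open>H\<close>; it serves both for changing back from a
  reflected basis and, with H = Q^T, for diagonalising.\<close>

lemma spectral_sum_mprod:
  "spectral_sum d (mprod d H Q) g a b = (\<Sum>p<d. \<Sum>q<d. H a p * spectral_sum d Q g p q * H b q)"
proof -
  have "spectral_sum d (mprod d H Q) g a b = (\<Sum>c<d. \<Sum>p<d. \<Sum>q<d. H a p * (g c * Q p c * Q q c) * H b q)"
    by (simp add: spectral_sum_def mprod_def sum_product mult_ac sum_distrib_left)
  also have "\<dots> = (\<Sum>p<d. \<Sum>c<d. \<Sum>q<d. H a p * (g c * Q p c * Q q c) * H b q)" by (rule sum.swap)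
  also have "\<dots> = (\<Sum>p<d. \<Sum>q<d. \<Sum>c<d. H a p * (g c * Q p c * Q q c) * H b q)"
    by (intro sum.cong refl sum.swap)
  finally show ?thesis by (simp add: spectral_sum_def sum_distrib_left sum_distrib_right)
qed

text \<open>Deflation: a reflection \<open>H\<close> takes the last unit vector to an eigenvector,
  so H f H splits off the last coordinate, and induction handles the leading block.\<close>

lemma spectral_decomposition:
  assumes "\<And>a b. a < d \<Longrightarrow> b < d \<Longrightarrow> f a b = f b a"
  shows "\<exists>Q g. orthonormal d Q \<and> (\<forall>a<d. \<forall>b<d. f a b = spectral_sum d Q g a b)"
  using assms
proof (induction d arbitrary: f)
  case 0
  show ?case by (simp add: orthonormal_def)
next
  case (Suc d)
  let ?n = "Suc d"
  obtain v e where fv: "\<And>a. a < ?n \<Longrightarrow> (\<Sum>b<?n. f a b * v b) = e * v a" and v: "(\<Sum>a<?n. (v a)\<^sup>2) = 1"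
    using real_symmetric_eigenvector[of ?n f] Suc.prems by auto
  obtain H where Hs: "\<And>a b. H a b = H b a" and H: "orthonormal ?n H"
    and Hd: "\<And>a. a < ?n \<Longrightarrow> H a d = v a"
    using householder_exists[OF v] by auto
  have HH: "(\<Sum>c<?n. H a c * H c b) = ident a b" if "a < ?n" "b < ?n" for a b
    using H that unfolding orthonormal_alt by (simp only: Hs[of a])
  define F where "F = mprod ?n H (mprod ?n f H)"
  have mmHd: "mprod ?n f H a d = e * v a" if "a < ?n" for a
    using fv[OF that] Hd by (simp add: mprod_def del: sum.lessThan_Suc)
  have Fd: "F a d = e * ident a d" if "a < ?n" for a
  proof -
    have "F a d = (\<Sum>c<?n. H a c * (e * H c d))"
      unfolding F_def mprod_def[of _ H] using mmHd Hd by (intro sum.cong refl) simp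
    also have "\<dots> = e * (\<Sum>c<?n. H a c * H c d)"
      unfolding sum_distrib_left by (intro sum.cong refl) simp
    finally show ?thesis using HH[OF that, of d] by simp
  qed
  have Fs: "F a b = F b a" if "a < ?n" "b < ?n" for a b
  proof -
    have "F a b = (\<Sum>p<?n. \<Sum>q<?n. H a p * (f p q * H q b))"
      by (simp only: F_def mprod_def sum_distrib_left)
    also have "\<dots> = (\<Sum>q<?n. \<Sum>p<?n. H a p * (f p q * H q b))" by (rule sum.swap)
    also have "\<dots> = (\<Sum>q<?n. \<Sum>p<?n. H b q * (f q p * H p a))"
    proof (intro sum.cong refl)
      fix p q assume "p \<in> {..<?n}" "q \<in> {..<?n}"
      then show "H a p * (f p q * H q b) = H b q * (f q p * H p a)"
        using Suc.prems[of p q] Hs[of a p] Hs[of q b] by simp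
    qed
    also have "\<dots> = F b a" by (simp only: F_def mprod_def sum_distrib_left)
    finally show ?thesis .
  qed
  obtain Q' g' where Q': "orthonormal d Q'" and F': "\<And>a b. a < d \<Longrightarrow> b < d \<Longrightarrow> F a b = spectral_sum d Q' g' a b"
    using Suc.IH[of F] Fs by auto
  \<comment> \<open>The eigenbasis of the leading block, extended by the last unit vector.\<close>
  define Q where "Q = (\<lambda>a c. if a < d \<and> c < d then Q' a c else ident a c)"
  define g where "g = g'(d := e)"
  have Q: "orthonormal ?n Q"
    unfolding orthonormal_alt
  proof (intro allI impI)
    fix a b assume "a < ?n" "b < ?n"
    then show "(\<Sum>c<?n. Q c a * Q c b) = ident a b"
      using Q' by (auto simp: Q_def ident_def orthonormal_def less_Suc_eq)
  qed
  have F: "F a b = spectral_sum ?n Q g a b" if ab: "a < ?n" "b < ?n" for a b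
  proof (cases "a < d \<and> b < d")
    case True
    then show ?thesis using F'[of a b] by (simp add: spectral_sum_def Q_def g_def ident_def)
  next
    case False
    then have "a = d \<or> b = d" using ab by auto
    then have "F a b = e * ident a b" using Fd Fs ab by (auto simp: ident_def)
    also have "\<dots> = spectral_sum ?n Q g a b"
      using False ab by (auto simp: spectral_sum_def Q_def g_def ident_def less_Suc_eq intro!: sum.neutral)
    finally show ?thesis .
  qed
  have "f a b = spectral_sum ?n (mprod ?n H Q) g a b" if ab: "a < ?n" "b < ?n" for a b
  proof -
    \<comment> \<open>\<open>H\<close> is its own inverse, so conjugating \<open>F\<close> by it
      recovers \<open>f\<close>.\<close>
    have "spectral_sum ?n (mprod ?n H Q) g a b = (\<Sum>p<?n. \<Sum>q<?n. H a p * F p q * H b q)"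
      unfolding spectral_sum_mprod using F by (intro sum.cong refl) simp
    also have "\<dots> = mprod ?n H (mprod ?n F H) a b"
      by (simp only: mprod_def sum_distrib_left mult.assoc Hs[of b])
    also have "\<dots> = mprod ?n (mprod ?n H H) (mprod ?n f (mprod ?n H H)) a b"
      by (simp only: F_def mprod_assoc)
    also have "\<dots> = f a b"
    proof -
      have "mprod ?n (mprod ?n H H) (mprod ?n f (mprod ?n H H)) a b = (\<Sum>p<?n. ident a p * (\<Sum>q<?n. f p q * ident q b))"
        unfolding mprod_def[of _ "mprod _ _ _"] mprod_def[of _ f] using HH ab
        by (intro sum.cong arg_cong2[of _ _ _ _ "(*)"] refl) (auto simp: mprod_def simp del: sum.lessThan_Suc)
      then show ?thesis using ab by (simp only: sum_ident)
    qed
    finally show ?thesis by simp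
  qed
  then show ?case using orthonormal_mprod[OF H Q] by blast
qed

lemma psd_spectral_decomposition:
  assumes f: "psd d f"
  shows "\<exists>Q g. orthonormal d Q \<and> (\<forall>c<d. 0 \<le> g c) \<and> (\<forall>a<d. \<forall>b<d. f a b = spectral_sum d Q g a b)"
proof -
  obtain Q g where Q: "orthonormal d Q" and fs: "\<forall>a<d. \<forall>b<d. f a b = spectral_sum d Q g a b"
    using spectral_decomposition[of d f] psd_sym[OF f] by blast
  have "0 \<le> g c" if c: "c < d" for c
  proof -
    have "0 \<le> qform d f (\<lambda>a. Q a c)" by (rule psd_qform[OF f])
    also have "\<dots> = qform d (spectral_sum d Q g) (\<lambda>a. Q a c)" using fs by (simp add: qform_def)
    also have "\<dots> = (\<Sum>b<d. g b * (ident c b)\<^sup>2)"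
      unfolding qform_spectral_sum using Q c by (intro sum.cong refl) (auto simp: orthonormal_alt)
    also have "\<dots> = g c" using c by (simp add: power2_eq_square ident_def if_distrib[of "\<lambda>x. _ * x"] cong: if_cong)
    finally show ?thesis .
  qed
  with Q fs show ?thesis by blast
qed

section \<open>Rank, spectral norm and pseudoinverse\<close>

lemma (in vec_space) rank_mult_le:
  assumes A: "A \<in> carrier_mat n m" and B: "B \<in> carrier_mat m p"
  shows "rank (A * B) \<le> rank A"
proof -
  have AB: "A * B \<in> carrier_mat n p" using A B by simp
  have sub: "span (set (cols (A * B))) \<subseteq> span (set (cols A))"
  proof
    fix x assume "x \<in> span (set (cols (A * B)))"
    then have "x \<in> {z \<in> carrier_vec n. \<exists>y\<in>carrier_vec p. (A * B) *\<^sub>v y = z}"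
      using col_space_eq[OF AB] A B unfolding col_space_def by auto
    then obtain y where x: "x \<in> carrier_vec n" and y: "y \<in> carrier_vec p" "(A * B) *\<^sub>v y = x"
      by blast
    have "A *\<^sub>v (B *\<^sub>v y) = x" using y assoc_mult_mat_vec[OF A B y(1)] by simp
    moreover have "B *\<^sub>v y \<in> carrier_vec m" using B y(1) by simp
    ultimately have "x \<in> {z \<in> carrier_vec n. \<exists>y\<in>carrier_vec m. A *\<^sub>v y = z}" using x by blast
    then show "x \<in> span (set (cols A))"
      using col_space_eq[OF A] A unfolding col_space_def by simp
  qed
  have colsA: "set (cols A) \<subseteq> carrier_vec n" using A cols_dim by blast
  have colsAB: "set (cols (A * B)) \<subseteq> carrier_vec n" using AB cols_dim by blast
  have sA: "subspace class_ring (span (set (cols A))) V" using colsA by (rule span_is_subspace)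
  have sAB: "subspace class_ring (span (set (cols (A * B)))) V" using colsAB by (rule span_is_subspace)
  show ?thesis
    unfolding rank_def
    using vectorspace.subspace_dim[OF subspace_is_vs[OF sA] nested_subspaces[OF sA sAB sub]
        fin_dim_span_cols[OF A]] fin_dim_span_cols[OF AB] by auto
qed

lemma (in vec_space) injective_full_rank:
  assumes A: "A \<in> carrier_mat n k"
    and inj: "\<And>v. v \<in> carrier_vec k \<Longrightarrow> A *\<^sub>v v = 0\<^sub>v n \<Longrightarrow> v = 0\<^sub>v k"
  shows "rank A = k"
proof -
  \<comment> \<open>Linear independence concerns the set of columns, so repeated columns must be
    excluded separately; they would put e_i - e_j into the kernel.\<close>
  have "distinct (cols A)"
    unfolding distinct_conv_nth
  proof (intro allI impI notI)
    fix i j assume ij: "i < length (cols A)" "j < length (cols A)" "i \<noteq> j" "cols A ! i = cols A ! j"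
    then have ik: "i < k" "j < k" and eq: "col A i = col A j" using A by auto
    have unit: "A *\<^sub>v unit_vec k l = col A l" if "l < k" for l
      using A that by (intro eq_vecI) (auto simp: scalar_prod_right_unit)
    have "A *\<^sub>v (unit_vec k i - unit_vec k j) = A *\<^sub>v unit_vec k i - A *\<^sub>v unit_vec k j"
      using A by (intro mult_minus_distrib_mat_vec) auto
    also have "\<dots> = 0\<^sub>v n"
      using A ik eq by (simp add: unit)
    finally have "unit_vec k i - unit_vec k j = (0\<^sub>v k :: 'a vec)" by (intro inj) auto
    then have "(unit_vec k i - unit_vec k j :: 'a vec) $ i = 0" using ik by simp
    then show False using ik ij(3) by simp
  qed
  moreover from this have "lin_indpt (set (cols A))" using lin_depE[OF A] inj by metis
  ultimately show ?thesis by (rule lin_indpt_full_rank[OF A])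
qed

section \<open>Gram matrices and the spectral norm\<close>

definition gram :: "real mat \<Rightarrow> nat \<Rightarrow> nat \<Rightarrow> real" where
  "gram A a b = (\<Sum>i<dim_row A. A $$ (i, a) * A $$ (i, b))"

lemma qform_gram:
  "qform d (gram A) v = (\<Sum>i<dim_row A. (\<Sum>a<d. A $$ (i, a) * v a)\<^sup>2)"
proof -
  have "qform d (gram A) v = (\<Sum>a<d. \<Sum>b<d. \<Sum>i<dim_row A. (A $$ (i, a) * v a) * (A $$ (i, b) * v b))"
    unfolding qform_def gram_def sum_distrib_left sum_distrib_right by (simp add: mult_ac)
  also have "\<dots> = (\<Sum>a<d. \<Sum>i<dim_row A. \<Sum>b<d. (A $$ (i, a) * v a) * (A $$ (i, b) * v b))"
    by (intro sum.cong refl sum.swap)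
  also have "\<dots> = (\<Sum>i<dim_row A. \<Sum>a<d. \<Sum>b<d. (A $$ (i, a) * v a) * (A $$ (i, b) * v b))"
    by (rule sum.swap)
  finally show ?thesis by (simp add: power2_eq_square sum_product)
qed

lemma psd_gram: "psd d (gram A)"
  unfolding psd_def qform_gram by (auto simp: gram_def mult.commute intro!: sum_nonneg)

lemma gram_eq:
  assumes "A \<in> carrier_mat n d" "a < d" "b < d"
  shows "(transpose_mat A * A) $$ (a, b) = gram A a b"
  using assms by (auto simp: gram_def scalar_prod_def atLeast0LessThan intro!: sum.cong)

lemma mult_mat_vec_sum:
  assumes "B \<in> carrier_mat n d" "x \<in> carrier_vec d" "i < n"
  shows "(B *\<^sub>v x) $ i = (\<Sum>a<d. B $$ (i, a) * x $ a)"
  using assms by (auto simp: scalar_prod_def atLeast0LessThan intro!: sum.cong)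

lemma euclidean_norm_sq: "(euclidean_norm x)\<^sup>2 = (\<Sum>i<dim_vec x. (x $ i)\<^sup>2)"
proof -
  have "x \<bullet> x = (\<Sum>i<dim_vec x. (x $ i)\<^sup>2)"
    by (simp add: scalar_prod_def atLeast0LessThan power2_eq_square)
  then show ?thesis by (simp add: euclidean_norm_def sum_nonneg)
qed

lemma euclidean_norm_nonneg: "0 \<le> euclidean_norm x"
  by (simp add: euclidean_norm_def scalar_prod_def sum_nonneg)

lemma euclidean_norm_mult_sq:
  assumes B: "B \<in> carrier_mat n d" and x: "x \<in> carrier_vec d"
  shows "(euclidean_norm (B *\<^sub>v x))\<^sup>2 = qform d (gram B) (\<lambda>a. x $ a)"
  using B mult_mat_vec_sum[OF B x]
  by (simp add: euclidean_norm_sq qform_gram del: index_mult_mat_vec)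

text \<open>The a priori bound \<open>c\<close> serves the lower estimate as well: it makes the set
  bounded above, so that its supremum is an upper bound.\<close>

lemma
  assumes B: "B \<in> carrier_mat n d"
    and c: "\<And>v. qform d (gram B) v \<le> c * (\<Sum>a<d. (v a)\<^sup>2)" and c0: "0 \<le> c"
  shows spectral_norm_sq_le: "(spectral_norm B)\<^sup>2 \<le> c"
    and spectral_norm_sq_ge: "\<And>v. (\<Sum>a<d. (v a)\<^sup>2) = 1 \<Longrightarrow> qform d (gram B) v \<le> (spectral_norm B)\<^sup>2"
proof -
  define X where "X = {euclidean_norm (B *\<^sub>v x) | x. x \<in> carrier_vec (dim_col B) \<and> euclidean_norm x \<le> 1}"
  have le: "y \<le> sqrt c" if y: "y \<in> X" for y
  proof -
    obtain x where x: "x \<in> carrier_vec d" "euclidean_norm x \<le> 1" and yx: "y = euclidean_norm (B *\<^sub>v x)"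
      using y B by (auto simp: X_def)
    have "y\<^sup>2 \<le> c * (euclidean_norm x)\<^sup>2"
      using c[of "\<lambda>a. x $ a"] x(1)
      unfolding yx euclidean_norm_mult_sq[OF B x(1)] by (simp add: euclidean_norm_sq)
    also have "\<dots> \<le> c * 1"
      using x(2) c0 euclidean_norm_nonneg[of x] by (intro mult_left_mono power_le_one) auto
    finally show ?thesis by (simp add: real_le_rsqrt)
  qed
  have bdd: "bdd_above X" using le by (auto simp: bdd_above_def)
  \<comment> \<open>The zero vector makes the set nonempty and the supremum nonnegative, as squaring
    requires.\<close>
  have zero: "euclidean_norm (B *\<^sub>v 0\<^sub>v d) \<in> X"
    using B by (auto simp: X_def euclidean_norm_def intro!: exI[of _ "0\<^sub>v d"])
  then have ne: "X \<noteq> {}" by blast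
  have 0: "0 \<le> spectral_norm B"
    using order_trans[OF euclidean_norm_nonneg cSup_upper[OF zero bdd]]
    by (simp add: spectral_norm_def X_def[symmetric])
  have "spectral_norm B \<le> sqrt c"
    unfolding spectral_norm_def X_def[symmetric] using ne le by (rule cSup_least)
  from power_mono[OF this 0, of 2] show "(spectral_norm B)\<^sup>2 \<le> c" using c0 by simp
  show "qform d (gram B) v \<le> (spectral_norm B)\<^sup>2" if v: "(\<Sum>a<d. (v a)\<^sup>2) = 1" for v
  proof -
    define x where "x = vec d v"
    have x: "x \<in> carrier_vec d" by (simp add: x_def)
    have "(euclidean_norm x)\<^sup>2 = 1" using v by (simp add: euclidean_norm_sq x_def)
    then have "euclidean_norm x \<le> 1" by (simp add: abs_square_eq_1)
    then have "euclidean_norm (B *\<^sub>v x) \<in> X" using B x by (auto simp: X_def)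
    then have "euclidean_norm (B *\<^sub>v x) \<le> spectral_norm B"
      unfolding spectral_norm_def X_def[symmetric] using bdd by (intro cSup_upper)
    from power_mono[OF this euclidean_norm_nonneg, of 2] show ?thesis
      using euclidean_norm_mult_sq[OF B x] by (simp add: x_def qform_def)
  qed
qed

section \<open>Column submatrices\<close>

text \<open>Each \<open>i\<close> in \<open>S\<close> is picked at the position given by the number
  of smaller elements of \<open>S\<close>; counting then turns surjectivity into
  injectivity.\<close>

lemma pick_bij:
  assumes "finite S"
  shows "bij_betw (pick S) {..<card S} S"
proof -
  have "S \<subseteq> pick S ` {..<card S}"
  proof
    fix i assume i: "i \<in> S"
    have "{a \<in> S. a < i} \<subset> S" using i by auto
    then have "card {a \<in> S. a < i} < card S" by (rule psubset_card_mono[OF assms])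
    then show "i \<in> pick S ` {..<card S}" 
      by (intro image_eqI[of _ _ "card {a \<in> S. a < i}"]) (simp_all only: pick_card_in_set[OF i] lessThan_iff)
  qed
  moreover have "card (pick S ` {..<card S}) \<le> card S"
    using card_image_le[of "{..<card S}" "pick S"] by simp
  ultimately have eq: "S = pick S ` {..<card S}" by (intro card_seteq) simp_all
  have "card (pick S ` {..<card S}) = card {..<card S}" using eq[symmetric] by (simp only: card_lessThan)
  then have "inj_on (pick S) {..<card S}" by (intro eq_card_imp_inj_on finite_lessThan)
  then show ?thesis using eq[symmetric] by (rule bij_betw_imageI)
qed

lemma sum_pick: "finite S \<Longrightarrow> (\<Sum>r<card S. F (pick S r)) = (\<Sum>c\<in>S. F c)"
  by (rule sum.reindex_bij_betw[OF pick_bij])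

lemma column_submatrix_carrier:
  assumes "A \<in> carrier_mat n d" "S \<subseteq> {..<d}"
  shows "column_submatrix A S \<in> carrier_mat n (card S)"
proof -
  have "{j. j < d \<and> j \<in> S} = S" using assms(2) by auto
  then show ?thesis
    using assms(1) by (intro carrier_matI) (simp_all add: column_submatrix_def dim_submatrix)
qed

lemma column_submatrix_index:
  assumes "A \<in> carrier_mat n d" "S \<subseteq> {..<d}" "i < n" "r < card S"
  shows "column_submatrix A S $$ (i, r) = A $$ (i, pick S r)"
proof -
  have "{j. j < d \<and> j \<in> S} = S" using assms(2) by auto
  then show ?thesis
    using assms(1,3,4) by (simp add: column_submatrix_def submatrix_index pick_UNIV)
qed

text \<open>Passes between index functions supported on \<open>S\<close> and coordinate vectors of
  length \<open>card S\<close>.\<close>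

lemma sum_supported:
  fixes h :: "nat \<Rightarrow> real"
  assumes "S \<subseteq> {..<d}" "\<And>c. c \<notin> S \<Longrightarrow> h c = 0"
  shows "(\<Sum>c<d. h c) = (\<Sum>r<card S. h (pick S r))"
proof -
  have "finite S" using assms(1) finite_subset by blast
  moreover have "(\<Sum>c<d. h c) = (\<Sum>c\<in>S. h c)"
    using assms by (intro sum.mono_neutral_right) auto
  ultimately show ?thesis by (simp add: sum_pick)
qed

lemma column_submatrix_injective:
  fixes A :: "real mat"
  assumes A: "A \<in> carrier_mat n d" and S: "S \<subseteq> {..<d}"
    and indep: "\<And>v a. (\<And>a. a \<notin> S \<Longrightarrow> v a = 0) \<Longrightarrow> (\<And>i. i < n \<Longrightarrow> (\<Sum>b<d. A $$ (i, b) * v b) = 0)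
      \<Longrightarrow> v a = 0"
    and w: "w \<in> carrier_vec (card S)" and z: "column_submatrix A S *\<^sub>v w = 0\<^sub>v n"
  shows "w = 0\<^sub>v (card S)"
proof -
  have bij: "bij_betw (pick S) {..<card S} S" using S finite_subset by (intro pick_bij) blast
  \<comment> \<open>\<open>w\<close> extended by zero to all columns, through the inverse of
    \<open>pick S\<close>.\<close>
  define v where "v = (\<lambda>c. if c \<in> S then w $ (inv_into {..<card S} (pick S) c) else 0)"
  have vp: "v (pick S r) = w $ r" if "r < card S" for r
    using that bij unfolding v_def bij_betw_def by (auto simp: inv_into_f_f)
  have v0: "v c = 0" if "c \<notin> S" for c using that by (simp add: v_def)
  have "(\<Sum>b<d. A $$ (i, b) * v b) = 0" if i: "i < n" for i
  proof -
    have "(\<Sum>b<d. A $$ (i, b) * v b) = (\<Sum>r<card S. A $$ (i, pick S r) * v (pick S r))"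
      by (rule sum_supported[OF S, of "\<lambda>b. A $$ (i, b) * v b"]) (simp add: v0)
    also have "\<dots> = (column_submatrix A S *\<^sub>v w) $ i"
      unfolding mult_mat_vec_sum[OF column_submatrix_carrier[OF A S] w i]
      using column_submatrix_index[OF A S i] vp by (intro sum.cong) auto
    finally show ?thesis using i by (simp add: z)
  qed
  from indep[OF v0 this] have "w $ r = 0" if "r < card S" for r using vp[OF that] by simp
  then show ?thesis using w by (intro eq_vecI) simp_all
qed

section \<open>Pseudoinverse and orthogonal projection\<close>

text \<open>Gives the description defining \<open>pseudoinverse\<close> its meaning. Transposing
  products of the symmetric matrices yields BX = BY and XB = YB, whence X = XBX = YBY.\<close>

lemma pseudoinverse_unique:
  assumes B: "B \<in> carrier_mat n k" and X: "is_pseudoinverse B X" and Y: "is_pseudoinverse B Y"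
  shows "X = Y"
proof -
  have Xc: "X \<in> carrier_mat k n" and Yc: "Y \<in> carrier_mat k n"
    using X Y B by (auto simp: is_pseudoinverse_def)
  have X1: "B * X * B = B" and X2: "X * B * X = X" and X3: "transpose_mat (B * X) = B * X"
    and X4: "transpose_mat (X * B) = X * B" using X by (auto simp: is_pseudoinverse_def)
  have Y1: "B * Y * B = B" and Y2: "Y * B * Y = Y" and Y3: "transpose_mat (B * Y) = B * Y"
    and Y4: "transpose_mat (Y * B) = Y * B" using Y by (auto simp: is_pseudoinverse_def)
  have BX: "B * X \<in> carrier_mat n n" and BY: "B * Y \<in> carrier_mat n n"
    and XB: "X * B \<in> carrier_mat k k" and YB: "Y * B \<in> carrier_mat k k"
    using B Xc Yc by auto
  have "B * X = B * Y * B * X" by (simp add: Y1)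
  also have "\<dots> = (B * Y) * (B * X)" by (rule assoc_mult_mat[OF BY B Xc])
  also have "\<dots> = transpose_mat ((B * X) * (B * Y))" by (simp add: transpose_mult[OF BX BY] X3 Y3)
  also have "(B * X) * (B * Y) = B * X * B * Y" by (rule assoc_mult_mat[OF BX B Yc, symmetric])
  finally have eq1: "B * X = B * Y" by (simp add: X1 Y3)
  have "X * B = X * (B * Y * B)" by (simp add: Y1)
  also have "\<dots> = X * (B * (Y * B))" using assoc_mult_mat[OF B Yc B] by simp
  also have "\<dots> = (X * B) * (Y * B)" by (rule assoc_mult_mat[OF Xc B YB, symmetric])
  also have "\<dots> = transpose_mat ((Y * B) * (X * B))" by (simp add: transpose_mult[OF YB XB] X4 Y4)
  also have "(Y * B) * (X * B) = Y * (B * (X * B))" by (rule assoc_mult_mat[OF Yc B XB])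
  also have "B * (X * B) = B * X * B" by (rule assoc_mult_mat[OF B Xc B, symmetric])
  finally have eq2: "X * B = Y * B" by (simp add: X1 Y4)
  have "X = X * B * X" by (simp add: X2)
  also have "\<dots> = Y * B * X" by (simp add: eq2)
  also have "\<dots> = Y * (B * X)" by (rule assoc_mult_mat[OF Yc B Xc])
  also have "\<dots> = Y * (B * Y)" by (simp add: eq1)
  also have "\<dots> = Y * B * Y" by (rule assoc_mult_mat[OF Yc B Yc, symmetric])
  finally show ?thesis by (simp add: Y2)
qed

text \<open>For injective \<open>B\<close> the matrix (B^T B)^-1 B^T is a left inverse that
  satisfies the Penrose conditions.\<close>

lemma is_pseudoinverse_pseudoinverse:
  assumes B: "B \<in> carrier_mat n k"
    and inj: "\<And>v. v \<in> carrier_vec k \<Longrightarrow> B *\<^sub>v v = 0\<^sub>v n \<Longrightarrow> v = 0\<^sub>v k"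
  shows "is_pseudoinverse B (pseudoinverse B)"
proof -
  define T where "T = transpose_mat B"
  have T: "T \<in> carrier_mat k n" using B by (simp add: T_def)
  have TB: "T * B \<in> carrier_mat k k" using T B by simp
  \<comment> \<open>A kernel vector \<open>v\<close> of B^T B has |B v|^2 = 0, contradicting
    injectivity.\<close>
  have "det (T * B) \<noteq> 0"
  proof
    assume "det (T * B) = 0"
    then obtain v where v: "v \<in> carrier_vec k" "v \<noteq> 0\<^sub>v k" "T * B *\<^sub>v v = 0\<^sub>v k"
      using det_0_iff_vec_prod_zero_field[OF TB] by auto
    have Bv: "B *\<^sub>v v \<in> carrier_vec n" using B v(1) by simp
    have "(B *\<^sub>v v) \<bullet> (B *\<^sub>v v) = v \<bullet> (T *\<^sub>v (B *\<^sub>v v))"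
      using transpose_vec_mult_scalar[OF B v(1) Bv] comm_scalar_prod[OF v(1), of "T *\<^sub>v (B *\<^sub>v v)"] T Bv
      by (simp add: T_def)
    also have "T *\<^sub>v (B *\<^sub>v v) = 0\<^sub>v k" using v(3) assoc_mult_mat_vec[OF T B v(1)] by simp
    finally have "(B *\<^sub>v v) \<bullet> (B *\<^sub>v v) = 0" using v(1) by simp
    then have "(\<Sum>i<n. ((B *\<^sub>v v) $ i)\<^sup>2) = 0"
      using Bv euclidean_norm_sq[of "B *\<^sub>v v"] unfolding euclidean_norm_def carrier_vecD[OF Bv]
      by (simp del: index_mult_mat_vec)
    then have "B *\<^sub>v v = 0\<^sub>v n"
      using Bv B by (intro eq_vecI) (auto simp: sum_nonneg_eq_0_iff simp del: index_mult_mat_vec)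
    then show False using inj v by blast
  qed
  then have "T * B \<in> Units (ring_mat TYPE(real) k undefined)" by (rule det_non_zero_imp_unit[OF TB])
  then obtain I where I: "T * B * I = 1\<^sub>m k" "I * (T * B) = 1\<^sub>m k" "I \<in> carrier_mat k k"
    by (auto simp: Units_def ring_mat_def)
  have IT: "transpose_mat I = I"
  proof -
    have mtrace: "transpose_mat (T * B) = T * B" unfolding transpose_mult[OF T B] by (simp add: T_def)
    have tI: "transpose_mat I \<in> carrier_mat k k" using I(3) by simp
    have "T * B * transpose_mat I = transpose_mat (I * (T * B))"
      by (simp add: transpose_mult[OF I(3) TB] mtrace)
    then have "T * B * transpose_mat I = 1\<^sub>m k" by (simp add: I(2))
    then have "I * (T * B * transpose_mat I) = I" using I(3) by simp
    then show ?thesis using assoc_mult_mat[OF I(3) TB tI] I(2) tI by simp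
  qed
  define X where "X = I * T"
  have Xc: "X \<in> carrier_mat k n" using I(3) T by (simp add: X_def)
  have XB: "X * B = 1\<^sub>m k" using assoc_mult_mat[OF I(3) T B] I(2) by (simp add: X_def)
  have "transpose_mat (B * X) = transpose_mat X * T" by (simp add: transpose_mult[OF B Xc] T_def)
  also have "transpose_mat X = B * I" by (simp add: X_def transpose_mult[OF I(3) T] IT) (simp add: T_def)
  also have "B * I * T = B * X" unfolding X_def by (rule assoc_mult_mat[OF B I(3) T])
  finally have X: "is_pseudoinverse B X"
    unfolding is_pseudoinverse_def using B Xc XB assoc_mult_mat[OF B Xc B] by auto
  show ?thesis
    unfolding pseudoinverse_def by (rule theI[of _ X], rule X, rule pseudoinverse_unique[OF B _ X])
qed

text \<open>With X the pseudoinverse, the projection BX fixes B C, and BX = X^T B^T annihilates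
  \<open>E\<close>, which is orthogonal to the columns of \<open>B\<close>.\<close>

lemma pseudoinverse_residual:
  assumes B: "B \<in> carrier_mat n k"
    and inj: "\<And>v. v \<in> carrier_vec k \<Longrightarrow> B *\<^sub>v v = 0\<^sub>v n \<Longrightarrow> v = 0\<^sub>v k"
    and C: "C \<in> carrier_mat k d" and E: "E \<in> carrier_mat n d"
    and A: "A = B * C + E" and orth: "transpose_mat B * E = 0\<^sub>m k d"
  shows "A - B * pseudoinverse B * A = E"
proof -
  define X where "X = pseudoinverse B"
  have X: "is_pseudoinverse B X" unfolding X_def by (rule is_pseudoinverse_pseudoinverse[OF B inj])
  have Xc: "X \<in> carrier_mat k n" using X B by (simp add: is_pseudoinverse_def)
  have BX: "B * X \<in> carrier_mat n n" and BC: "B * C \<in> carrier_mat n d" using B Xc C by auto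
  have "B * X * E = transpose_mat (B * X) * E" using X by (simp add: is_pseudoinverse_def)
  also have "\<dots> = transpose_mat X * transpose_mat B * E" by (simp add: transpose_mult[OF B Xc])
  also have "\<dots> = transpose_mat X * (transpose_mat B * E)"
    using B Xc E by (intro assoc_mult_mat) auto
  also have "\<dots> = 0\<^sub>m n d" using Xc by (simp add: orth)
  finally have 1: "B * X * E = 0\<^sub>m n d" .
  have "B * X * (B * C) = B * X * B * C" by (rule assoc_mult_mat[OF BX B C, symmetric])
  then have 2: "B * X * (B * C) = B * C" using X by (simp add: is_pseudoinverse_def)
  have cancel: "P + E - P = E" if "P \<in> carrier_mat n d" "E \<in> carrier_mat n d" for P E :: "real mat"
    using that by (intro eq_matI) auto
  have "B * X * A = B * C"
    unfolding A mult_add_distrib_mat[OF BX BC E] 1 2 using BC by simp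
  then show ?thesis
    using cancel[OF BC E] by (simp add: X_def A)
qed

section \<open>Eigenvalues of the Gram matrix\<close>

lemma mult_mat_index_sum:
  assumes "A \<in> carrier_mat n m" "B \<in> carrier_mat m p" "i < n" "j < p"
  shows "(A * B) $$ (i, j) = (\<Sum>c<m. A $$ (i, c) * B $$ (c, j))"
  using assms by (auto simp: scalar_prod_def atLeast0LessThan intro!: sum.cong)

lemma orthonormal_rows:
  assumes Q: "orthonormal d Q" and ab: "a < d" "b < d"
  shows "(\<Sum>c<d. Q a c * Q b c) = ident a b"
proof -
  define P where "P = mat d d (\<lambda>(a, c). Q a c)"
  have P: "P \<in> carrier_mat d d" by (simp add: P_def)
  have "transpose_mat P * P = 1\<^sub>m d"
    using Q unfolding P_def
    by (intro eq_matI) (auto simp: scalar_prod_def atLeast0LessThan orthonormal_def)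
  then have "P * transpose_mat P = 1\<^sub>m d"
    using P by (intro mat_mult_left_right_inverse[of "transpose_mat P" d P]) auto
  then have "(P * transpose_mat P) $$ (a, b) = ident a b" using ab by (simp add: ident_def)
  then show ?thesis using ab by (simp add: P_def scalar_prod_def atLeast0LessThan)
qed

text \<open>M = P D P^T is similar to a diagonal matrix, so the list behind
  \<open>nth_largest_eigenvalue\<close> is a sorted rearrangement of \<open>g\<close>.\<close>

lemma proots_char_poly_spectral_sum:
  assumes Q: "orthonormal d Q" and M: "M \<in> carrier_mat d d"
    and Ms: "\<And>a b. a < d \<Longrightarrow> b < d \<Longrightarrow> M $$ (a, b) = spectral_sum d Q g a b"
  shows "proots (char_poly M) = mset (map g [0..<d])"
proof -
  define P where "P = mat d d (\<lambda>(a, c). Q a c)"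
  define D where "D = mat d d (\<lambda>(a, c). if a = c then g a else 0)"
  have P: "P \<in> carrier_mat d d" and D: "D \<in> carrier_mat d d" by (simp_all add: P_def D_def)
  have 1: "transpose_mat P * P = 1\<^sub>m d"
    using Q unfolding P_def
    by (intro eq_matI) (auto simp: scalar_prod_def atLeast0LessThan orthonormal_def)
  then have 2: "P * transpose_mat P = 1\<^sub>m d"
    using P by (intro mat_mult_left_right_inverse[of "transpose_mat P" d P]) auto
  have PD: "(P * D) $$ (a, c) = Q a c * g c" if "a < d" "c < d" for a c
    using that by (simp add: P_def D_def scalar_prod_def atLeast0LessThan if_distrib[of "\<lambda>x. _ * x"] cong: if_cong)
  have roots: "(\<Sum>p\<leftarrow>map (\<lambda>a. [:- a, 1:]) xs. proots p) = mset xs" for xs :: "real list"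
    by (induction xs) simp_all
  have "M = P * D * transpose_mat P"
  proof (rule eq_matI)
    fix a b assume "a < dim_row (P * D * transpose_mat P)" "b < dim_col (P * D * transpose_mat P)"
    then have ab: "a < d" "b < d" using P by simp_all
    have "(P * D * transpose_mat P) $$ (a, b) = (\<Sum>c<d. (P * D) $$ (a, c) * transpose_mat P $$ (c, b))"
      using P D ab by (intro mult_mat_index_sum) auto
    also have "\<dots> = spectral_sum d Q g a b"
      unfolding spectral_sum_def
    proof (intro sum.cong refl)
      fix c assume "c \<in> {..<d}"
      then have c: "c < d" and "transpose_mat P $$ (c, b) = Q b c" using ab by (simp_all add: P_def)
      then show "(P * D) $$ (a, c) * transpose_mat P $$ (c, b) = g c * Q a c * Q b c"
        unfolding PD[OF ab(1) c] by simp
    qed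
    finally show "M $$ (a, b) = (P * D * transpose_mat P) $$ (a, b)" using Ms[OF ab] by simp
  qed (use M P D in auto)
  then have "similar_mat_wit M D P (transpose_mat P)"
    using 1 2 M P D by (auto simp: similar_mat_wit_def Let_def)
  then have "char_poly M = char_poly D" by (intro char_poly_similar) (auto simp: similar_mat_def)
  also have "\<dots> = (\<Prod>a\<leftarrow>diag_mat D. [:- a, 1:])"
    by (rule char_poly_upper_triangular[OF D]) (auto simp: D_def)
  also have "diag_mat D = map g [0..<d]" by (auto simp: diag_mat_def D_def)
  finally have "char_poly M = (\<Prod>p\<leftarrow>map (\<lambda>a. [:- a, 1:]) (map g [0..<d]). p)" by simp
  also have "proots \<dots> = (\<Sum>p\<leftarrow>map (\<lambda>a. [:- a, 1:]) (map g [0..<d]). proots p)"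
    by (rule proots_prod_list) auto
  also have "\<dots> = mset (map g [0..<d])" by (rule roots)
  finally show ?thesis .
qed

text \<open>The columns of A Q are pairwise orthogonal with squared lengths \<open>g\<close>: (AQ)^T
  (AQ) = Q^T (A^T A) Q.\<close>

lemma spectral_sum_columns:
  assumes Q: "orthonormal d Q" and A: "A \<in> carrier_mat n d"
    and gr: "\<And>a b. a < d \<Longrightarrow> b < d \<Longrightarrow> gram A a b = spectral_sum d Q g a b" and ce: "c < d" "e < d"
  shows "(\<Sum>i<n. (\<Sum>a<d. A $$ (i, a) * Q a c) * (\<Sum>a<d. A $$ (i, a) * Q a e)) = g c * ident c e"
proof -
  \<comment> \<open>\<open>H\<close> is Q^T, so \<open>mprod d H Q\<close> is the identity.\<close>
  define H where "H = (\<lambda>c a. Q a c)"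
  have "(\<Sum>i<n. (\<Sum>a<d. A $$ (i, a) * Q a c) * (\<Sum>a<d. A $$ (i, a) * Q a e))
    = (\<Sum>i<n. \<Sum>a<d. \<Sum>b<d. H c a * (A $$ (i, a) * A $$ (i, b)) * H e b)"
    by (simp add: H_def sum_product mult_ac)
  also have "\<dots> = (\<Sum>a<d. \<Sum>i<n. \<Sum>b<d. H c a * (A $$ (i, a) * A $$ (i, b)) * H e b)" by (rule sum.swap)
  also have "\<dots> = (\<Sum>a<d. \<Sum>b<d. \<Sum>i<n. H c a * (A $$ (i, a) * A $$ (i, b)) * H e b)"
    by (intro sum.cong refl sum.swap)
  also have "\<dots> = (\<Sum>a<d. \<Sum>b<d. H c a * gram A a b * H e b)"
    using A by (simp add: gram_def sum_distrib_left sum_distrib_right)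
  also have "\<dots> = (\<Sum>a<d. \<Sum>b<d. H c a * spectral_sum d Q g a b * H e b)"
    using gr by (intro sum.cong refl) simp
  also have "\<dots> = spectral_sum d (mprod d H Q) g c e" by (rule spectral_sum_mprod[symmetric])
  also have "\<dots> = (\<Sum>b<d. g b * ident c b * ident e b)"
    unfolding spectral_sum_def using Q ce by (intro sum.cong refl) (simp add: mprod_def H_def orthonormal_alt)
  also have "\<dots> = (\<Sum>b<d. (g b * ident e b) * ident c b)" by (simp add: mult_ac)
  also have "\<dots> = g c * ident c e" unfolding sum_ident(2)[OF ce(1)] by (simp only: ident_commute[of e])
  finally show ?thesis .
qed

text \<open>\<open>P\<close> collects the eigenvectors with nonzero eigenvalue. The columns of A P
  are orthogonal and nonzero, and A = (A P) P^T because the other columns of A Q vanish; so A and A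
  P have equal rank.\<close>

lemma rank_eq_card_nonzero:
  assumes Q: "orthonormal d Q" and A: "A \<in> carrier_mat n d"
    and gr: "\<And>a b. a < d \<Longrightarrow> b < d \<Longrightarrow> gram A a b = spectral_sum d Q g a b"
  shows "vec_space.rank n A = card {c \<in> {..<d}. g c \<noteq> 0}"
proof -
  define C where "C = {c \<in> {..<d}. g c \<noteq> 0}"
  have C: "C \<subseteq> {..<d}" by (auto simp: C_def)
  define F where "F = (\<lambda>i c. \<Sum>a<d. A $$ (i, a) * Q a c)"
  have FF: "(\<Sum>i<n. F i c * F i e) = g c * ident c e" if "c < d" "e < d" for c e
    unfolding F_def by (rule spectral_sum_columns[OF Q A gr that])
  define Qm where "Qm = mat d d (\<lambda>(a, c). Q a c)"
  have Qm: "Qm \<in> carrier_mat d d" by (simp add: Qm_def)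
  define P where "P = column_submatrix Qm C"
  have P: "P \<in> carrier_mat d (card C)" unfolding P_def by (rule column_submatrix_carrier[OF Qm C])
  have AQ: "A * Qm \<in> carrier_mat n d" using A Qm by simp
  have AQF: "(A * Qm) $$ (i, c) = F i c" if "i < n" "c < d" for i c
    using that A by (auto simp: Qm_def F_def scalar_prod_def atLeast0LessThan intro!: sum.cong)
  have pickd: "pick C r < d" if "r < card C" for r
    using pick_bij[of C] that C finite_subset[OF C] by (auto simp: bij_betw_def)
  have Pr: "P $$ (a, r) = Q a (pick C r)" if "a < d" "r < card C" for a r
    unfolding P_def column_submatrix_index[OF Qm C that] using that pickd by (simp add: Qm_def)
  have APF: "(A * P) $$ (i, r) = F i (pick C r)" if "i < n" "r < card C" for i r
    using that A P Pr by (auto simp: F_def scalar_prod_def atLeast0LessThan intro!: sum.cong)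
  have AP: "A * P = column_submatrix (A * Qm) C"
  proof (rule eq_matI)
    fix i r assume "i < dim_row (column_submatrix (A * Qm) C)" "r < dim_col (column_submatrix (A * Qm) C)"
    then have ir: "i < n" "r < card C" using column_submatrix_carrier[OF AQ C] by auto
    show "(A * P) $$ (i, r) = column_submatrix (A * Qm) C $$ (i, r)"
      unfolding column_submatrix_index[OF AQ C ir] APF[OF ir] AQF[OF ir(1) pickd[OF ir(2)]] ..
  qed (use A P column_submatrix_carrier[OF AQ C] in auto)
  have "v e = 0" if v: "\<And>c. c \<notin> C \<Longrightarrow> v c = 0"
    and z: "\<And>i. i < n \<Longrightarrow> (\<Sum>b<d. (A * Qm) $$ (i, b) * v b) = 0" for v e
  proof (cases "e \<in> C")
    case True
    then have e: "e < d" "g e \<noteq> 0" by (auto simp: C_def)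
    have "0 = (\<Sum>i<n. F i e * (\<Sum>b<d. F i b * v b))"
      using z AQF by (intro sum.neutral[symmetric]) auto
    also have "\<dots> = (\<Sum>i<n. \<Sum>b<d. v b * (F i e * F i b))"
      by (simp add: sum_distrib_left mult_ac)
    also have "\<dots> = (\<Sum>b<d. v b * (\<Sum>i<n. F i e * F i b))"
      by (subst sum.swap) (simp add: sum_distrib_left)
    also have "\<dots> = (\<Sum>b<d. (v b * g e) * ident e b)" using FF[OF e(1)] by (intro sum.cong) auto
    also have "\<dots> = v e * g e" using e(1) by simp
    finally show ?thesis using e(2) by simp
  qed (rule v)
  then have "w = 0\<^sub>v (card C)" if "w \<in> carrier_vec (card C)" "(A * P) *\<^sub>v w = 0\<^sub>v n" for w
    using that column_submatrix_injective[OF AQ C] unfolding AP by blast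
  then have rAP: "vec_space.rank n (A * P) = card C"
    using A P by (intro vec_space.injective_full_rank) auto
  have "A = (A * P) * transpose_mat P"
  proof (rule eq_matI)
    fix i j assume "i < dim_row ((A * P) * transpose_mat P)" "j < dim_col ((A * P) * transpose_mat P)"
    then have ij: "i < n" "j < d" using A P by auto
    have F0: "F i c = 0" if "c < d" "c \<notin> C" for c
    proof -
      have "(\<Sum>i<n. F i c * F i c) = 0" using FF[of c c] that by (simp add: C_def)
      then show ?thesis using ij(1) by (subst (asm) sum_nonneg_eq_0_iff) auto
    qed
    have "((A * P) * transpose_mat P) $$ (i, j) = (\<Sum>r<card C. (A * P) $$ (i, r) * transpose_mat P $$ (r, j))"
      using ij A P by (intro mult_mat_index_sum) auto
    also have "\<dots> = (\<Sum>r<card C. (A * P) $$ (i, r) * P $$ (j, r))"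
      using ij P by (intro sum.cong) auto
    also have "\<dots> = (\<Sum>r<card C. F i (pick C r) * Q j (pick C r))"
      using ij by (intro sum.cong) (auto simp: APF Pr)
    also have "\<dots> = (\<Sum>c\<in>C. F i c * Q j c)"
      using finite_subset[OF C] by (intro sum_pick) auto
    also have "\<dots> = (\<Sum>c<d. F i c * Q j c)"
      using C F0 by (intro sum.mono_neutral_left) auto
    also have "\<dots> = (\<Sum>c<d. \<Sum>a<d. A $$ (i, a) * (Q a c * Q j c))"
      by (simp add: F_def sum_distrib_right mult.assoc)
    also have "\<dots> = (\<Sum>a<d. A $$ (i, a) * (\<Sum>c<d. Q a c * Q j c))"
      by (subst sum.swap) (simp add: sum_distrib_left)
    also have "\<dots> = (\<Sum>a<d. A $$ (i, a) * ident a j)"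
      using orthonormal_rows[OF Q _ ij(2)] by (intro sum.cong) auto
    also have "\<dots> = A $$ (i, j)" using ij by simp
    finally show "A $$ (i, j) = ((A * P) * transpose_mat P) $$ (i, j)" ..
  qed (use A P in auto)
  then have "vec_space.rank n A \<le> card C"
    using vec_space.rank_mult_le[of "A * P" n "card C" "transpose_mat P" d] A P rAP by simp
  moreover have "card C \<le> vec_space.rank n A"
    using vec_space.rank_mult_le[OF A P] rAP by simp
  ultimately show ?thesis by (simp add: C_def)
qed

text \<open>Applied below to the positions of the nonzero entries of a descending list.\<close>

lemma downward_closed_eq_lessThan:
  fixes X :: "nat set"
  assumes fin: "finite X" and down: "\<And>i j. j \<in> X \<Longrightarrow> i \<le> j \<Longrightarrow> i \<in> X"
  shows "X = {..<card X}"
proof (rule card_seteq[OF fin, symmetric])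
  show "{..<card X} \<subseteq> X"
  proof (rule ccontr)
    assume "\<not> ?thesis"
    then obtain i where i: "i < card X" "i \<notin> X" by auto
    have "X \<subseteq> {..<i}" using down i(2) by (meson lessThan_iff not_less subsetI)
    then have "card X \<le> i" using card_mono[of "{..<i}" X] by simp
    with i show False by simp
  qed
qed simp

text \<open>The \<open>t\<close> positive eigenvalues come first in the descending list and the
  remaining \<open>d - t\<close> are zero, so sums of \<open>F\<close> with \<open>F 0 = 0\<close>
  can stop at \<open>t\<close>.\<close>

lemma
  fixes g :: "nat \<Rightarrow> real"
  assumes M: "proots (char_poly M) = mset (map g [0..<d])" and g: "\<And>c. c < d \<Longrightarrow> 0 \<le> g c"
    and t: "t = card {c \<in> {..<d}. g c \<noteq> 0}"
  shows nth_largest_eigenvalue_pos: "\<And>i. 1 \<le> i \<Longrightarrow> i \<le> t \<Longrightarrow> 0 < nth_largest_eigenvalue M i"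
    and nth_largest_eigenvalue_antimono:
      "\<And>i j. 1 \<le> i \<Longrightarrow> i \<le> j \<Longrightarrow> j \<le> t \<Longrightarrow> nth_largest_eigenvalue M j \<le> nth_largest_eigenvalue M i"
    and sum_nth_largest_eigenvalue:
      "\<And>F :: real \<Rightarrow> real. F 0 = 0 \<Longrightarrow> (\<Sum>c<d. F (g c)) = (\<Sum>i = 1..t. F (nth_largest_eigenvalue M i))"
    and le_largest_eigenvalue: "\<And>c. c < d \<Longrightarrow> g c \<le> nth_largest_eigenvalue M 1"
    and largest_eigenvalue_attained: "0 < d \<Longrightarrow> \<exists>c<d. g c = nth_largest_eigenvalue M 1"
proof -
  define L where "L = rev (sorted_list_of_multiset (proots (char_poly M)))"
  have lam: "nth_largest_eigenvalue M i = L ! (i - 1)" for i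
    by (simp add: nth_largest_eigenvalue_def L_def)
  have mL: "mset L = mset (map g [0..<d])" by (simp add: L_def M)
  have len: "length L = d" using arg_cong[OF mL, of size] by simp
  have set: "set L = g ` {..<d}" using arg_cong[OF mL, of set_mset] by auto
  have desc: "L ! j \<le> L ! i" if "i \<le> j" "j < d" for i j
  proof -
    have "sorted (rev L)" by (simp add: L_def)
    then show ?thesis using that len by (simp add: sorted_rev_nth_mono)
  qed
  have sumL: "(\<Sum>c<d. F (g c)) = (\<Sum>i<d. F (L ! i))" for F :: "real \<Rightarrow> real"
  proof -
    have "(\<Sum>c<d. F (g c)) = sum_mset (image_mset F (mset (map g [0..<d])))"
      by (simp add: sum_mset_sum_list sum_list_sum_nth atLeast0LessThan flip: mset_map)
    also have "\<dots> = (\<Sum>i<d. F (L ! i))"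
      unfolding mL[symmetric] by (simp add: sum_mset_sum_list sum_list_sum_nth atLeast0LessThan len flip: mset_map)
    finally show ?thesis .
  qed
  have nn: "0 \<le> L ! i" if "i < d" for i
    using nth_mem[of i L] that g by (auto simp: len set)
  define X where "X = {i \<in> {..<d}. L ! i \<noteq> 0}"
  have eqX: "X = {..<card X}"
  proof (rule downward_closed_eq_lessThan)
    fix i j assume j: "j \<in> X" "i \<le> j"
    then have "0 < L ! j" using nn[of j] by (auto simp: X_def)
    also have "\<dots> \<le> L ! i" using j by (intro desc) (auto simp: X_def)
    finally show "i \<in> X" using j by (auto simp: X_def)
  qed (simp add: X_def)
  \<comment> \<open>Counting is written as a sum of indicators, which is invariant under the
    rearrangement of \<open>g\<close> into \<open>L\<close>.\<close>
  have "real (card X) = real t"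
  proof -
    have ind: "real (card {c \<in> {..<d}. h c \<noteq> 0}) = (\<Sum>c<d. if h c \<noteq> 0 then 1 else 0)" for h :: "nat \<Rightarrow> real"
    proof -
      have "real (card {c \<in> {..<d}. h c \<noteq> 0}) = (\<Sum>c\<in>{c \<in> {..<d}. h c \<noteq> 0}. 1)" by simp
      also have "\<dots> = (\<Sum>c<d. if h c \<noteq> 0 then 1 else 0)" by (rule sum.inter_filter) simp
      finally show ?thesis .
    qed
    show ?thesis unfolding X_def t ind by (rule sumL[of "\<lambda>x. if x \<noteq> 0 then 1 else 0", symmetric])
  qed
  then have ct: "card X = t" by simp
  have X: "X = {..<t}" by (rule eqX[unfolded ct])
  have td: "t \<le> d" using card_mono[of "{..<d}" X] ct by (auto simp: X_def)
  show "0 < nth_largest_eigenvalue M i" if "1 \<le> i" "i \<le> t" for i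
  proof -
    have "i - 1 \<in> X" unfolding X using that by auto
    then show ?thesis using nn[of "i - 1"] by (auto simp: X_def lam)
  qed
  show "nth_largest_eigenvalue M j \<le> nth_largest_eigenvalue M i" if "1 \<le> i" "i \<le> j" "j \<le> t" for i j
    unfolding lam using that td by (intro desc) auto
  show "(\<Sum>c<d. F (g c)) = (\<Sum>i = 1..t. F (nth_largest_eigenvalue M i))" if F: "F 0 = 0" for F :: "real \<Rightarrow> real"
  proof -
    have "(\<Sum>c<d. F (g c)) = (\<Sum>i\<in>X. F (L ! i))"
      unfolding sumL using F by (intro sum.mono_neutral_right) (auto simp: X_def)
    also have "\<dots> = (\<Sum>i<t. F (nth_largest_eigenvalue M (Suc i)))" by (simp add: X lam)
    also have "\<dots> = (\<Sum>i = 1..t. F (nth_largest_eigenvalue M i))"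
      by (simp add: sum.atLeast1_atMost_eq)
    finally show ?thesis .
  qed
  show "g c \<le> nth_largest_eigenvalue M 1" if "c < d" for c
  proof -
    have "g c \<in> set L" using that by (simp add: set)
    then obtain i where "i < d" "L ! i = g c" by (metis in_set_conv_nth len)
    then show ?thesis using desc[of 0 i] by (simp add: lam)
  qed
  show "\<exists>c<d. g c = nth_largest_eigenvalue M 1" if "0 < d"
  proof -
    have "L ! 0 \<in> set L" using that len by (intro nth_mem) simp
    then show ?thesis by (auto simp: set lam)
  qed
qed

section \<open>Column selection\<close>

text \<open>With E = A - A W, the invariant reads A^T E = N. Rows of \<open>N\<close> in
  \<open>S\<close> vanish, so \<open>E\<close> is orthogonal to the chosen columns; as
  \<open>W\<close> is supported on \<open>S\<close>, also W^T A^T E = 0 and E^T E = N.\<close>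

lemma eliminated_residual:
  assumes A: "A \<in> carrier_mat n d" and e: "eliminated d (gram A) S N"
  defines "B \<equiv> column_submatrix A S"
  shows "\<exists>C E. C \<in> carrier_mat (card S) d \<and> E \<in> carrier_mat n d \<and> A = B * C + E \<and>
    transpose_mat B * E = 0\<^sub>m (card S) d \<and> (\<forall>a<d. \<forall>b<d. gram E a b = N a b)"
proof -
  have S: "S \<subseteq> {..<d}" and rows: "\<And>a b. a \<in> S \<Longrightarrow> b < d \<Longrightarrow> N a b = 0"
    using e by (simp_all add: eliminated_def)
  have B: "B \<in> carrier_mat n (card S)" unfolding B_def by (rule column_submatrix_carrier[OF A S])
  obtain W where W0: "\<And>a b. a \<notin> S \<Longrightarrow> W a b = 0"
    and W: "\<And>a b. a < d \<Longrightarrow> b < d \<Longrightarrow> N a b = gram A a b - mprod d (gram A) W a b"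
    using eliminated_coeffs[OF e] by metis
  have pickS: "pick S r \<in> S" if "r < card S" for r
    using pick_bij[OF finite_subset[OF S finite_lessThan]] that by (auto simp: bij_betw_def)
  define R where "R = (\<lambda>i b. A $$ (i, b) - (\<Sum>c<d. A $$ (i, c) * W c b))"
  define C where "C = mat (card S) d (\<lambda>(r, b). W (pick S r) b)"
  define E where "E = mat n d (\<lambda>(i, b). R i b)"
  have C: "C \<in> carrier_mat (card S) d" and E: "E \<in> carrier_mat n d" by (simp_all add: C_def E_def)
  have AR: "(\<Sum>i<n. A $$ (i, a) * R i b) = N a b" if ab: "a < d" "b < d" for a b
  proof -
    have "(\<Sum>i<n. A $$ (i, a) * R i b) =
        (\<Sum>i<n. A $$ (i, a) * A $$ (i, b)) - (\<Sum>i<n. \<Sum>c<d. A $$ (i, a) * A $$ (i, c) * W c b)"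
      by (simp add: R_def right_diff_distrib sum_subtractf sum_distrib_left mult.assoc)
    also have "(\<Sum>i<n. \<Sum>c<d. A $$ (i, a) * A $$ (i, c) * W c b) = mprod d (gram A) W a b"
      using A by (subst sum.swap) (simp add: mprod_def gram_def sum_distrib_right)
    finally show ?thesis using W[OF ab] A by (simp add: gram_def)
  qed
  have RR: "gram E a b = N a b" if ab: "a < d" "b < d" for a b
  proof -
    have "gram E a b = (\<Sum>i<n. R i a * R i b)" using ab by (simp add: gram_def E_def)
    also have "\<dots> = (\<Sum>i<n. A $$ (i, a) * R i b) - (\<Sum>i<n. \<Sum>c<d. W c a * (A $$ (i, c) * R i b))"
      unfolding sum_subtractf[symmetric]
    proof (intro sum.cong refl)
      fix i
      have "R i a * R i b = (A $$ (i, a) - (\<Sum>c<d. A $$ (i, c) * W c a)) * R i b"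
        by (simp only: R_def)
      also have "\<dots> = A $$ (i, a) * R i b - (\<Sum>c<d. W c a * (A $$ (i, c) * R i b))"
        unfolding left_diff_distrib sum_distrib_right by (simp add: mult_ac)
      finally show "R i a * R i b = A $$ (i, a) * R i b - (\<Sum>c<d. W c a * (A $$ (i, c) * R i b))" .
    qed
    also have "(\<Sum>i<n. \<Sum>c<d. W c a * (A $$ (i, c) * R i b)) = (\<Sum>c<d. W c a * N c b)"
      using AR[OF _ ab(2)] by (subst sum.swap) (simp add: sum_distrib_left[symmetric])
    also have "\<dots> = 0"
      using W0 rows[OF _ ab(2)] by (intro sum.neutral) (metis mult_zero_left mult_zero_right)
    finally show ?thesis using AR[OF ab] by simp
  qed
  have "A = B * C + E"
  proof (rule eq_matI)
    fix i b assume "i < dim_row (B * C + E)" "b < dim_col (B * C + E)"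
    then have ib: "i < n" "b < d" using E by auto
    have "(B * C) $$ (i, b) = (\<Sum>r<card S. A $$ (i, pick S r) * W (pick S r) b)"
      unfolding mult_mat_index_sum[OF B C ib] using ib column_submatrix_index[OF A S ib(1)]
      by (intro sum.cong) (auto simp: B_def C_def)
    also have "\<dots> = (\<Sum>c<d. A $$ (i, c) * W c b)"
      by (rule sum_supported[OF S, of "\<lambda>c. A $$ (i, c) * W c b", symmetric]) (simp add: W0)
    finally show "A $$ (i, b) = (B * C + E) $$ (i, b)" using ib E by (simp add: E_def R_def)
  qed (use A E in auto)
  moreover have "transpose_mat B * E = 0\<^sub>m (card S) d"
  proof (rule eq_matI)
    fix r b assume "r < dim_row (0\<^sub>m (card S) d :: real mat)" "b < dim_col (0\<^sub>m (card S) d :: real mat)"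
    then have rb: "r < card S" "b < d" by auto
    have "(transpose_mat B * E) $$ (r, b) = (\<Sum>i<n. transpose_mat B $$ (r, i) * E $$ (i, b))"
      using B E rb by (intro mult_mat_index_sum) auto
    also have "\<dots> = (\<Sum>i<n. A $$ (i, pick S r) * R i b)"
    proof (intro sum.cong refl)
      fix i assume "i \<in> {..<n}"
      then have i: "i < n" by simp
      have "transpose_mat B $$ (r, i) = B $$ (i, r)" using B rb i by simp
      then show "transpose_mat B $$ (r, i) * E $$ (i, b) = A $$ (i, pick S r) * R i b"
        using column_submatrix_index[OF A S i rb(1)] i rb by (simp add: B_def E_def)
    qed
    also have "\<dots> = 0"
      using AR[OF _ rb(2)] rows[OF pickS[OF rb(1)] rb(2)] pickS[OF rb(1)] S by auto
    finally show "(transpose_mat B * E) $$ (r, b) = 0\<^sub>m (card S) d $$ (r, b)" using rb by simp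
  qed (use B E in auto)
  ultimately show ?thesis using C E RR by blast
qed

lemma eliminated_injective:
  assumes A: "A \<in> carrier_mat n d" and e: "eliminated d (gram A) S N"
    and w: "w \<in> carrier_vec (card S)" "column_submatrix A S *\<^sub>v w = 0\<^sub>v n"
  shows "w = 0\<^sub>v (card S)"
proof -
  have S: "S \<subseteq> {..<d}" using e by (simp add: eliminated_def)
  have "v c = 0" if v: "\<And>a. a \<notin> S \<Longrightarrow> v a = 0"
    and z: "\<And>i. i < n \<Longrightarrow> (\<Sum>b<d. A $$ (i, b) * v b) = 0" for v c
  proof -
    have "(\<Sum>b<d. gram A a b * v b) = 0" for a
    proof -
      have "(\<Sum>b<d. gram A a b * v b) = (\<Sum>b<d. \<Sum>i<n. A $$ (i, a) * (A $$ (i, b) * v b))"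
        using A by (simp add: gram_def sum_distrib_right mult.assoc)
      also have "\<dots> = (\<Sum>i<n. A $$ (i, a) * (\<Sum>b<d. A $$ (i, b) * v b))"
        by (subst sum.swap) (simp add: sum_distrib_left)
      finally show ?thesis using z by simp
    qed
    then show ?thesis using eliminated_indep[OF e, of v] v by blast
  qed
  then show ?thesis using column_submatrix_injective[OF A S _ w] by blast
qed

lemma eliminated_rank:
  assumes A: "A \<in> carrier_mat n d" and e: "eliminated d (gram A) S N"
  shows "vec_space.rank n (column_submatrix A S) = card S"
  using e eliminated_injective[OF A e] column_submatrix_carrier[OF A]
  by (intro vec_space.injective_full_rank) (auto simp: eliminated_def)

lemma eliminated_projection_gram:
  assumes A: "A \<in> carrier_mat n d" and e: "eliminated d (gram A) S N" and ab: "a < d" "b < d"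
  defines "B \<equiv> column_submatrix A S"
  shows "A - B * pseudoinverse B * A \<in> carrier_mat n d"
    "gram (A - B * pseudoinverse B * A) a b = N a b"
proof -
  have B: "B \<in> carrier_mat n (card S)"
    unfolding B_def using e by (intro column_submatrix_carrier[OF A]) (simp add: eliminated_def)
  obtain C E where "C \<in> carrier_mat (card S) d" and E: "E \<in> carrier_mat n d" and "A = B * C + E"
    and "transpose_mat B * E = 0\<^sub>m (card S) d" and gr: "\<forall>a<d. \<forall>b<d. gram E a b = N a b"
    using eliminated_residual[OF A e] unfolding B_def by blast
  then have eq: "A - B * pseudoinverse B * A = E"
    using eliminated_injective[OF A e] by (intro pseudoinverse_residual[OF B]) (auto simp: B_def)
  show "A - B * pseudoinverse B * A \<in> carrier_mat n d" unfolding eq by (rule E)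
  show "gram (A - B * pseudoinverse B * A) a b = N a b" unfolding eq using gr ab by blast
qed

text \<open>If \<open>N\<close> vanished, so would \<open>E\<close>, and A = B C would have rank at
  most \<open>card S\<close>.\<close>

lemma eliminated_nonzero:
  assumes A: "A \<in> carrier_mat n d" and e: "eliminated d (gram A) S N"
    and less: "card S < vec_space.rank n A"
  shows "\<exists>a<d. \<exists>b<d. N a b \<noteq> 0"
proof (rule ccontr)
  assume z: "\<not> ?thesis"
  define B where "B = column_submatrix A S"
  have B: "B \<in> carrier_mat n (card S)"
    unfolding B_def using e by (intro column_submatrix_carrier[OF A]) (simp add: eliminated_def)
  obtain C E where C: "C \<in> carrier_mat (card S) d" and E: "E \<in> carrier_mat n d" and AE: "A = B * C + E"
    and gr: "\<forall>a<d. \<forall>b<d. gram E a b = N a b"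
    using eliminated_residual[OF A e] unfolding B_def by blast
  have "E $$ (i, b) = 0" if ib: "i < n" "b < d" for i b
  proof -
    have "(\<Sum>i<n. E $$ (i, b) * E $$ (i, b)) = 0" using gr z ib E by (auto simp: gram_def)
    then show ?thesis using ib(1) by (subst (asm) sum_nonneg_eq_0_iff) auto
  qed
  then have "A = B * C" using B C E by (intro eq_matI) (auto simp: AE)
  then have "vec_space.rank n A \<le> vec_space.rank n B" using vec_space.rank_mult_le[OF B C] by simp
  also have "\<dots> \<le> card S" by (rule vec_space.rank_le_nc[OF B])
  finally show False using less by simp
qed

text \<open>From K (I - x N) = N, the vector w = v - x N v satisfies K w = N v. Hence |v|^2 - x v^T
  N v = v^T w = |w|^2 + x w^T K w, which is nonnegative.\<close>

lemma shifted_qform_bound: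
  assumes K: "psd d K" and s: "shifted d x K N" and x: "0 \<le> x"
  shows "x * qform d N v \<le> (\<Sum>a<d. (v a)\<^sup>2)"
proof -
  define Nv where "Nv = (\<lambda>a. \<Sum>b<d. N a b * v b)"
  define w where "w = (\<lambda>a. v a - x * Nv a)"
  have Kw: "(\<Sum>b<d. K a b * w b) = Nv a" if a: "a < d" for a
  proof -
    have "(\<Sum>b<d. K a b * w b) = (\<Sum>b<d. K a b * v b) - x * (\<Sum>b<d. K a b * Nv b)"
      by (simp add: w_def right_diff_distrib sum_subtractf sum_distrib_left mult_ac)
    also have "(\<Sum>b<d. K a b * Nv b) = (\<Sum>b<d. \<Sum>c<d. K a b * N b c * v c)"
      by (simp add: Nv_def sum_distrib_left mult.assoc)
    also have "\<dots> = (\<Sum>c<d. mprod d K N a c * v c)"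
      by (subst sum.swap) (simp add: mprod_def sum_distrib_right)
    also have "x * \<dots> = (\<Sum>c<d. (K a c - N a c) * v c)"
      unfolding sum_distrib_left using shiftedD[OF s a] by (intro sum.cong) auto
    finally show ?thesis by (simp add: Nv_def left_diff_distrib sum_subtractf)
  qed
  have "(\<Sum>a<d. (v a)\<^sup>2) - x * qform d N v = (\<Sum>a<d. v a * w a)"
    by (simp add: qform_def w_def Nv_def right_diff_distrib sum_subtractf sum_distrib_left
        power2_eq_square mult_ac)
  also have "\<dots> = (\<Sum>a<d. (w a)\<^sup>2 + x * (w a * (\<Sum>b<d. K a b * w b)))"
  proof (intro sum.cong refl)
    fix a assume "a \<in> {..<d}"
    then show "v a * w a = (w a)\<^sup>2 + x * (w a * (\<Sum>b<d. K a b * w b))"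
      using Kw[of a] by (simp add: w_def power2_eq_square algebra_simps)
  qed
  also have "\<dots> = (\<Sum>a<d. (w a)\<^sup>2) + x * qform d K w"
    by (simp add: sum.distrib qform_def sum_distrib_left mult.assoc)
  also have "\<dots> \<ge> 0" using x psd_qform[OF K] by (intro add_nonneg_nonneg sum_nonneg) auto
  finally show ?thesis by simp
qed

text \<open>The start \<open>p\<close> may be negative, hence the guard on the sign of the final
  barrier.\<close>

lemma exists_eliminated:
  assumes A: "A \<in> carrier_mat n d" and rank: "vec_space.rank n A = t" and k: "0 < k" "k < t"
    and Q: "orthonormal d Q" and g: "\<And>c. c < d \<Longrightarrow> 0 \<le> g c"
    and gr: "\<And>a b. a < d \<Longrightarrow> b < d \<Longrightarrow> gram A a b = spectral_sum d Q g a b"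
    and p: "\<And>c. c < d \<Longrightarrow> p * g c < 1" and \<phi>: "0 < \<phi>" "(\<Sum>c<d. g c / (1 - p * g c)) \<le> \<phi>"
  shows "\<exists>S N. eliminated d (gram A) S N \<and> card S = k \<and>
    (0 \<le> p + real k / \<phi> \<longrightarrow> (\<forall>v. (p + real k / \<phi>) * qform d N v \<le> (\<Sum>a<d. (v a)\<^sup>2)))"
proof -
  define x where "x = real k / (real (Suc k) * \<phi>)"
  have x: "0 \<le> x" "x * \<phi> < 1" using \<phi>(1) by (simp_all add: x_def)
  define G0 where "G0 = spectral_sum d Q (\<lambda>c. g c / (1 - p * g c))"
  have "psd d G0"
    unfolding G0_def using g p by (intro psd_spectral_sum divide_nonneg_pos) auto
  moreover have "shifted d p G0 (gram A)"
  proof -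
    have "p * g c \<noteq> 1" if "c < d" for c using p[OF that] by simp
    then have "shifted d p G0 (spectral_sum d Q g)" unfolding G0_def by (rule shifted_spectral_sum[OF Q])
    then show ?thesis using gr by (simp add: shifted_def mprod_def)
  qed
  moreover have "mtrace d G0 \<le> \<phi>" using \<phi>(2) by (simp add: G0_def mtrace_spectral_sum[OF Q])
  ultimately obtain S N G where e: "eliminated d (gram A) S N" and c: "card S = k" and G: "psd d G"
    and s: "shifted d (p + real k * x) G N" and trG: "mtrace d G \<le> \<phi>"
    using greedy_elimination[of d "gram A" G0 p \<phi> x t k, OF psd_spectral_decomposition psd_gram _ _ _ x]
      eliminated_nonzero[OF A] rank k(2) by auto
  obtain Q' h where Qh: "orthonormal d Q' \<and> (\<forall>c<d. 0 \<le> h c) \<and> (\<forall>a<d. \<forall>b<d. G a b = spectral_sum d Q' h a b)"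
    using psd_spectral_decomposition[OF G] by blast
  then have Q': "orthonormal d Q'" and h: "\<And>c. c < d \<Longrightarrow> 0 \<le> h c"
    and Gh: "\<And>a b. a < d \<Longrightarrow> b < d \<Longrightarrow> G a b = spectral_sum d Q' h a b" by auto
  have "mtrace d G = (\<Sum>c<d. h c)" using mtrace_spectral_sum[OF Q', of h] Gh by (simp add: mtrace_def)
  then have xh: "x * h c < 1" if "c < d" for c
    using mult_left_mono[OF order_trans[OF sum_nonneg_member_le[of d h, OF h that]] x(1)] trG x(2)
    by fastforce
  \<comment> \<open>The final move, with no elimination after it.\<close>
  define K where "K = spectral_sum d Q' (\<lambda>c. h c / (1 - x * h c))"
  have K: "psd d K" unfolding K_def using h xh by (intro psd_spectral_sum divide_nonneg_pos) auto
  have "x * h c \<noteq> 1" if "c < d" for c using xh[OF that] by simp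
  then have "shifted d x K (spectral_sum d Q' h)" unfolding K_def by (rule shifted_spectral_sum[OF Q'])
  then have "shifted d x K G" using Gh by (simp add: shifted_def mprod_def)
  from shifted_trans[OF s this] have "shifted d (p + real k * x + x) K N" .
  moreover have "p + real k * x + x = p + real k / \<phi>"
  proof -
    have "real k * x + x = real (Suc k) * x" by (simp add: algebra_simps)
    also have "\<dots> = real k / \<phi>" unfolding x_def by (simp del: of_nat_Suc)
    finally show ?thesis by simp
  qed
  ultimately have "shifted d (p + real k / \<phi>) K N" by simp
  then show ?thesis using e c shifted_qform_bound[OF K] by blast
qed

section \<open>The optimal constant\<close>

text \<open>Convexity of \<open>1 / (r - p)\<close> to the right of \<open>p\<close>: the chord over
  [a, b] lies above the graph.\<close>

lemma inverse_le_chord: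
  fixes a b r p :: real
  assumes p: "p < a" and r: "a \<le> r" "r \<le> b" and ab: "a < b"
  shows "1 / (r - p) \<le> ((b - r) / (b - a)) / (a - p) + ((r - a) / (b - a)) / (b - p)"
proof -
  have pos: "0 < a - p" "0 < b - p" "0 < r - p" "0 < b - a" using assms by auto
  have "((b - r) / (b - a)) / (a - p) + ((r - a) / (b - a)) / (b - p) - 1 / (r - p)
      = (r - a) * (b - r) / ((a - p) * (b - p) * (r - p))"
    using pos by (simp add: divide_simps) (simp add: algebra_simps)
  also have "\<dots> \<ge> 0" using pos r by simp
  finally show ?thesis by simp
qed

text \<open>With \<open>p = a - u l\<close> and \<open>l = b - a\<close> the left-hand side is \<open>p + k / \<phi> - a\<close>, where \<open>\<phi> / t\<close> is the
  mean of \<open>1 / (r - p)\<close> for mass \<open>\<beta>\<close> at \<open>r = a\<close> and \<open>1 - \<beta>\<close> at \<open>r = b\<close>.  The witness \<open>u = w - \<beta>\<close> is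
  its maximiser.\<close>

lemma optimal_barrier:
  fixes \<beta> \<kappa> l :: real
  assumes \<beta>: "0 < \<beta>" "\<beta> < \<kappa>" and \<kappa>: "\<kappa> < 1" and l: "0 < l"
  shows "\<exists>u>0. \<kappa> / ((\<beta> / (u * l)) + (1 - \<beta>) / (l + u * l)) - u * l
    = l * (1 - \<beta>) * (sqrt \<kappa> - sqrt (\<beta> / (1 - \<beta>) * (1 - \<kappa>)))\<^sup>2"
proof -
  \<comment> \<open>In terms of w = u + \<beta>, the left-hand side divided by \<open>l\<close> is
    \<open>\<kappa> * (w + 1 - 2 * \<beta> - \<beta> * (1 - \<beta>) / w) - (w - \<beta>)\<close>,
    whose derivative vanishes here. That \<open>w\<close> exceeds \<open>\<beta>\<close> is
    equivalent to \<open>\<beta> < \<kappa>\<close>.\<close>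
  define w where "w = sqrt (\<kappa> * \<beta> * (1 - \<beta>) / (1 - \<kappa>))"
  have w2: "w\<^sup>2 = \<kappa> * \<beta> * (1 - \<beta>) / (1 - \<kappa>)" using assms by (simp add: w_def)
  have "\<beta>\<^sup>2 < w\<^sup>2"
  proof -
    have "\<beta> * (1 - \<kappa>) < \<kappa> * (1 - \<beta>)" using \<beta> by (simp add: algebra_simps)
    then have "\<beta> * (\<beta> * (1 - \<kappa>)) < \<beta> * (\<kappa> * (1 - \<beta>))" using \<beta> by (intro mult_strict_left_mono) auto
    then show ?thesis unfolding w2 using \<kappa> by (simp add: field_simps power2_eq_square)
  qed
  moreover have w0: "0 \<le> w" using assms by (simp add: w_def)
  ultimately have w: "\<beta> < w" by (rule power_less_imp_less_base)
  define u where "u = w - \<beta>"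
  have u: "0 < u" using w by (simp add: u_def)
  have wpos: "w > 0" using w \<beta> by simp
  have kw: "\<kappa> * (\<beta> * (1 - \<beta>)) / w = (1 - \<kappa>) * w"
    using w2 \<kappa> wpos by (simp add: field_simps power2_eq_square)
  have "\<beta> / (u * l) + (1 - \<beta>) / (l + u * l) = w / (u * (1 + u) * l)"
  proof -
    have "l + u * l = (1 + u) * l" by (simp add: algebra_simps)
    then show ?thesis using u l by (simp only:) (simp add: divide_simps, simp add: u_def algebra_simps)
  qed
  then have "\<kappa> / (\<beta> / (u * l) + (1 - \<beta>) / (l + u * l)) - u * l = l * (\<kappa> * (u * (1 + u)) / w - u)"
    using wpos by (simp add: algebra_simps)
  also have "u * (1 + u) = w * (w + 1 - 2 * \<beta>) - \<beta> * (1 - \<beta>)"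
    by (simp add: u_def algebra_simps)
  also have "\<kappa> * (w * (w + 1 - 2 * \<beta>) - \<beta> * (1 - \<beta>)) / w = \<kappa> * (w + 1 - 2 * \<beta>) - \<kappa> * (\<beta> * (1 - \<beta>)) / w"
    using wpos by (simp add: field_simps)
  also have "\<dots> - u = \<kappa> * (1 - \<beta>) + \<beta> * (1 - \<kappa>) - 2 * ((1 - \<kappa>) * w)"
    unfolding kw by (simp add: u_def algebra_simps)
  \<comment> \<open>This becomes the cross term of the square; both sides are nonnegative, so their
    squares are compared.\<close>
  also have "(1 - \<kappa>) * w = (1 - \<beta>) * (sqrt \<kappa> * sqrt (\<beta> / (1 - \<beta>) * (1 - \<kappa>)))"
  proof (rule power2_eq_imp_eq)
    have "((1 - \<kappa>) * w)\<^sup>2 = (1 - \<kappa>) * \<kappa> * \<beta> * (1 - \<beta>)"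
      using \<kappa> by (simp add: power_mult_distrib w2) (simp add: power2_eq_square)
    moreover have "((1 - \<beta>) * (sqrt \<kappa> * sqrt (\<beta> / (1 - \<beta>) * (1 - \<kappa>))))\<^sup>2
        = (1 - \<kappa>) * \<kappa> * \<beta> * (1 - \<beta>)"
      using assms by (simp add: power_mult_distrib) (simp add: power2_eq_square)
    ultimately show "((1 - \<kappa>) * w)\<^sup>2 = ((1 - \<beta>) * (sqrt \<kappa> * sqrt (\<beta> / (1 - \<beta>) * (1 - \<kappa>))))\<^sup>2"
      by simp
    show "0 \<le> (1 - \<kappa>) * w" using \<kappa> w0 by simp
    show "0 \<le> (1 - \<beta>) * (sqrt \<kappa> * sqrt (\<beta> / (1 - \<beta>) * (1 - \<kappa>)))" using assms by simp
  qed
  also have "l * (\<kappa> * (1 - \<beta>) + \<beta> * (1 - \<kappa>) - 2 * ((1 - \<beta>) * (sqrt \<kappa> * sqrt (\<beta> / (1 - \<beta>) * (1 - \<kappa>)))))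
      = l * (1 - \<beta>) * (sqrt \<kappa> - sqrt (\<beta> / (1 - \<beta>) * (1 - \<kappa>)))\<^sup>2"
  proof -
    have "(1 - \<beta>) * (sqrt (\<beta> / (1 - \<beta>) * (1 - \<kappa>)))\<^sup>2 = \<beta> * (1 - \<kappa>)" using assms by simp
    moreover have "(sqrt \<kappa>)\<^sup>2 = \<kappa>" using assms by simp
    ultimately show ?thesis
      unfolding mult.assoc power2_diff by (simp only: right_diff_distrib distrib_left mult_ac)
  qed
  finally show ?thesis using u by blast
qed

text \<open>Parseval's identity gives the upper bound, the eigenvector \<open>c0\<close> the lower
  one.\<close>

lemma spectral_norm_sq_eq_largest:
  assumes A: "A \<in> carrier_mat n d" and Q: "orthonormal d Q"
    and gr: "\<And>a b. a < d \<Longrightarrow> b < d \<Longrightarrow> gram A a b = spectral_sum d Q g a b"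
    and le: "\<And>c. c < d \<Longrightarrow> g c \<le> m" and c0: "c0 < d" "g c0 = m" and m: "0 \<le> m"
  shows "(spectral_norm A)\<^sup>2 = m" "\<And>v. qform d (gram A) v \<le> m * (\<Sum>a<d. (v a)\<^sup>2)"
proof -
  have q: "qform d (gram A) v = (\<Sum>c<d. g c * (\<Sum>a<d. v a * Q a c)\<^sup>2)" for v
    unfolding qform_spectral_sum[symmetric] using gr by (simp add: qform_def)
  have parseval: "(\<Sum>c<d. (\<Sum>a<d. v a * Q a c)\<^sup>2) = (\<Sum>a<d. (v a)\<^sup>2)" for v
  proof -
    have "(\<Sum>c<d. (\<Sum>a<d. v a * Q a c)\<^sup>2) = qform d (spectral_sum d Q (\<lambda>_. 1)) v" by (simp add: qform_spectral_sum)
    also have "\<dots> = (\<Sum>a<d. \<Sum>b<d. v a * ident a b * v b)"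
      unfolding qform_def spectral_sum_def using orthonormal_rows[OF Q] by (intro sum.cong refl) simp
    also have "\<dots> = (\<Sum>a<d. v a * (\<Sum>b<d. ident a b * v b))"
      by (simp only: sum_distrib_left mult.assoc)
    also have "\<dots> = (\<Sum>a<d. (v a)\<^sup>2)" by (intro sum.cong refl) (simp add: power2_eq_square)
    finally show ?thesis .
  qed
  show ub: "qform d (gram A) v \<le> m * (\<Sum>a<d. (v a)\<^sup>2)" for v
    unfolding q parseval[of v, symmetric] sum_distrib_left using le by (intro sum_mono mult_right_mono) auto
  have col: "(\<Sum>a<d. Q a c0 * Q a c) = ident c0 c" if "c < d" for c
    using Q c0(1) that by (simp add: orthonormal_alt)
  have "qform d (gram A) (\<lambda>a. Q a c0) = (\<Sum>c<d. (g c * ident c0 c) * ident c0 c)"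
    unfolding q using col by (intro sum.cong refl) (simp add: power2_eq_square)
  also have "\<dots> = m" unfolding sum_ident(2)[OF c0(1)] using c0 by (simp add: ident_def)
  finally have "m \<le> (spectral_norm A)\<^sup>2"
    using spectral_norm_sq_ge[OF A ub m, of "\<lambda>a. Q a c0"] col[OF c0(1)]
    by (simp add: power2_eq_square ident_def)
  with spectral_norm_sq_le[OF A ub m] show "(spectral_norm A)\<^sup>2 = m" by simp
qed

theorem theorem1p1:
  fixes n d t :: nat
    and A :: "real mat"
    and lam :: "nat \<Rightarrow> real"
    and \<alpha> \<beta> :: real
    and \<gamma> :: "nat \<Rightarrow> real"
  assumes A: "A \<in> carrier_mat n d"
    and rank: "vec_space.rank n A = t"
    and lam: "\<And>i. lam i = nth_largest_eigenvalue (transpose_mat A * A) i"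
    and lam_less: "lam t < lam 1"
    and alpha: "inverse \<alpha> = 1 / real t * (\<Sum>i = 1..t. inverse (lam i))"
    and beta: "\<beta> = (inverse (lam t) - inverse \<alpha>) / (inverse (lam t) - inverse (lam 1))"
    and gamma: "\<And>k. \<gamma> k =
      (sqrt (real k / real t) - sqrt (\<beta> / (1 - \<beta>) * (1 - real k / real t)))\<^sup>2"
  shows "\<beta> \<in> {0<..<1} \<and>
    (\<forall>k::nat. 0 < k \<and> \<beta> * real t \<le> real k \<and> k < t \<longrightarrow>
      \<gamma> k \<in> {0..<1} \<and>
      (\<exists>S \<subseteq> {0..<d}. card S = k \<and>
        vec_space.rank n (column_submatrix A S) = k \<and>
        (spectral_norm
          (A - column_submatrix A S * pseudoinverse (column_submatrix A S) * A))\<^sup>2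
        \<le> 1 / (1 + ((spectral_norm A)\<^sup>2 * inverse \<alpha> - 1) * \<gamma> k) * (spectral_norm A)\<^sup>2))"
proof -
  obtain Q g where Qg: "orthonormal d Q \<and> (\<forall>c<d. 0 \<le> g c) \<and> (\<forall>a<d. \<forall>b<d. gram A a b = spectral_sum d Q g a b)"
    using psd_spectral_decomposition[OF psd_gram] by blast
  then have Q: "orthonormal d Q" and g: "\<And>c. c < d \<Longrightarrow> 0 \<le> g c"
    and gr: "\<And>a b. a < d \<Longrightarrow> b < d \<Longrightarrow> gram A a b = spectral_sum d Q g a b" by auto
  define M where "M = transpose_mat A * A"
  have M: "M \<in> carrier_mat d d" using A by (simp add: M_def)
  have roots: "proots (char_poly M) = mset (map g [0..<d])"
    by (rule proots_char_poly_spectral_sum[OF Q M]) (simp add: M_def gram_eq[OF A] gr)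
  have tg: "t = card {c \<in> {..<d}. g c \<noteq> 0}" using rank_eq_card_nonzero[OF Q A gr] rank by simp
  have lamM: "lam i = nth_largest_eigenvalue M i" for i by (simp add: lam M_def)
  have lam_pos: "0 < lam i" if "1 \<le> i" "i \<le> t" for i
    unfolding lamM using nth_largest_eigenvalue_pos[OF roots g tg] that by blast
  have lam_anti: "lam j \<le> lam i" if "1 \<le> i" "i \<le> j" "j \<le> t" for i j
    unfolding lamM using nth_largest_eigenvalue_antimono[OF roots g tg] that by blast
  have sum_lam: "(\<Sum>c<d. F (g c)) = (\<Sum>i = 1..t. F (lam i))" if "F 0 = 0" for F :: "real \<Rightarrow> real"
    unfolding lamM by (rule sum_nth_largest_eigenvalue[OF roots g tg]) (use that in auto)
  have le1: "g c \<le> lam 1" if "c < d" for c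
    unfolding lamM by (rule le_largest_eigenvalue[OF roots g tg]) (use that in auto)
  \<comment> \<open>At \<open>t = 0\<close> the truncated index \<open>i - 1\<close> makes
    \<open>lam 0\<close> and \<open>lam 1\<close> the same entry, contradicting
    \<open>lam_less\<close>.\<close>
  have "t \<noteq> 0"
  proof
    assume "t = 0"
    with lam_less show False by (simp add: lam nth_largest_eigenvalue_def)
  qed
  with lam_less have t: "1 < t" by (cases "t = 1") auto
  have d: "0 < d"
  proof (rule ccontr)
    assume "\<not> 0 < d"
    then show False using t unfolding tg by simp
  qed
  obtain c0 where c0: "c0 < d" "g c0 = lam 1"
    using largest_eigenvalue_attained[OF roots g tg] d unfolding lamM by blast
  have l1: "0 < lam 1" and lt: "0 < lam t" using lam_pos t by auto
  note norm = spectral_norm_sq_eq_largest[of A n d Q g "lam 1" c0, OF A Q gr le1 c0 less_imp_le[OF l1]]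
  have normA: "(spectral_norm A)\<^sup>2 = lam 1" by (rule norm(1))
  \<comment> \<open>\<open>a\<close> and \<open>b\<close> are the extreme reciprocals and
    \<open>m\<close> is their mean over all \<open>t\<close>; then m = \<beta> a + (1 - \<beta>)
    b.\<close>
  define a b m where "a = 1 / lam 1" and "b = 1 / lam t" and "m = inverse \<alpha>"
  define r where "r = (\<lambda>i. 1 / lam i)"
  have ab: "0 < a" "a < b" using l1 lt lam_less by (simp_all add: a_def b_def frac_less2)
  have r: "a \<le> r i" "r i \<le> b" if "1 \<le> i" "i \<le> t" for i
    using that lam_pos lam_anti[of 1 i] lam_anti[of i t] t
    by (simp_all add: a_def b_def r_def frac_le)
  have m: "real t * m = (\<Sum>i = 1..t. r i)"
    using t by (simp only: m_def alpha) (simp add: r_def inverse_eq_divide)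
  have "(\<Sum>i = 1..t. a) < (\<Sum>i = 1..t. r i)"
    using r t ab by (intro sum_strict_mono_ex1 bexI[of _ t]) (auto simp: r_def b_def)
  then have "real t * a < real t * m" unfolding m by simp
  then have ma: "a < m" using t by simp
  have "(\<Sum>i = 1..t. r i) < (\<Sum>i = 1..t. b)"
    using r t ab by (intro sum_strict_mono_ex1 bexI[of _ 1]) (auto simp: r_def a_def)
  then have "real t * m < real t * b" unfolding m by simp
  then have mb: "m < b" using t by simp
  have \<beta>: "\<beta> = (b - m) / (b - a)" by (simp add: beta a_def b_def m_def inverse_eq_divide)
  have \<beta>01: "0 < \<beta>" "\<beta> < 1" using ma mb by (simp_all add: \<beta>)
  have \<beta>m: "(b - a) * (1 - \<beta>) = m - a" using ma mb by (simp add: \<beta> field_simps)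
  have "\<gamma> k \<in> {0..<1} \<and>
      (\<exists>S \<subseteq> {0..<d}. card S = k \<and>
        vec_space.rank n (column_submatrix A S) = k \<and>
        (spectral_norm
          (A - column_submatrix A S * pseudoinverse (column_submatrix A S) * A))\<^sup>2
        \<le> 1 / (1 + ((spectral_norm A)\<^sup>2 * inverse \<alpha> - 1) * \<gamma> k) * (spectral_norm A)\<^sup>2)"
    if k: "0 < k" "\<beta> * real t \<le> real k" "k < t" for k
  proof
    define \<kappa> where "\<kappa> = real k / real t"
    have \<kappa>: "0 < \<kappa>" "\<kappa> < 1" "\<beta> \<le> \<kappa>" using k t by (simp_all add: \<kappa>_def le_divide_eq)
    have \<gamma>: "\<gamma> k = (sqrt \<kappa> - sqrt (\<beta> / (1 - \<beta>) * (1 - \<kappa>)))\<^sup>2" by (simp add: gamma \<kappa>_def)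
    \<comment> \<open>From \<beta> \<le> \<kappa> the difference of the roots lies between 0 and
      \<open>sqrt \<kappa>\<close>, so \<gamma> k \<le> \<kappa> < 1.\<close>
    have "\<beta> / (1 - \<beta>) * (1 - \<kappa>) \<le> \<kappa>" using \<beta>01 \<kappa> by (simp add: field_simps)
    then have "sqrt (\<beta> / (1 - \<beta>) * (1 - \<kappa>)) \<le> sqrt \<kappa>" by simp
    moreover have "0 \<le> sqrt (\<beta> / (1 - \<beta>) * (1 - \<kappa>))" using \<beta>01 \<kappa> by simp
    ultimately have "\<gamma> k \<le> (sqrt \<kappa>)\<^sup>2" unfolding \<gamma> by (intro power_mono) auto
    then show \<gamma>01: "\<gamma> k \<in> {0..<1}" using \<kappa> by (simp add: \<gamma>)
    \<comment> \<open>The barrier position to be reached: the claimed bound is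
      \<open>1 / x\<close>.\<close>
    define x where "x = a + (m - a) * \<gamma> k"
    have "0 \<le> (m - a) * \<gamma> k" using ma \<gamma>01 by simp
    then have x: "0 < x" using ab by (simp add: x_def)
    have rhs: "1 / (1 + ((spectral_norm A)\<^sup>2 * inverse \<alpha> - 1) * \<gamma> k) * (spectral_norm A)\<^sup>2 = 1 / x"
    proof -
      have "1 + (lam 1 * m - 1) * \<gamma> k = lam 1 * x" using l1 by (simp add: x_def a_def field_simps)
      then show ?thesis using l1 x unfolding m_def[symmetric] normA by simp
    qed
    have "\<exists>S N. eliminated d (gram A) S N \<and> card S = k \<and>
        (\<forall>v. qform d N v \<le> 1 / x * (\<Sum>a<d. (v a)\<^sup>2))"
    proof (cases "\<beta> = \<kappa>")
      \<comment> \<open>The optimal \<open>u\<close> would be 0, placing \<open>p\<close> at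
        \<open>a\<close>, where the barrier is singular. But now \<gamma> k = 0 and the bound is
        \<open>lam 1\<close>; since elimination never increases the form, the start
        \<open>p = 0\<close> will do.\<close>
      case True
      have "\<gamma> k = 0" unfolding \<gamma> using True \<kappa> by simp
      then have x1: "1 / x = lam 1" by (simp add: x_def a_def)
      have "0 < g c0" using c0 l1 by simp
      also have "\<dots> \<le> (\<Sum>c<d. g c)" using g c0(1) by (rule sum_nonneg_member_le)
      finally have "0 < (\<Sum>c<d. g c)" .
      then obtain S N where e: "eliminated d (gram A) S N" "card S = k"
        using exists_eliminated[of A n d t k Q g 0 "\<Sum>c<d. g c", OF A rank k(1,3) Q g gr] by auto
      have "qform d N v \<le> 1 / x * (\<Sum>a<d. (v a)\<^sup>2)" for v
      proof -
        have "qform d N v \<le> qform d (gram A) v" using e(1) by (simp add: eliminated_def)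
        also have "\<dots> \<le> 1 / x * (\<Sum>a<d. (v a)\<^sup>2)" unfolding x1 by (rule norm(2))
        finally show ?thesis .
      qed
      with e show ?thesis by blast
    next
      case False
      then have "\<beta> < \<kappa>" using \<kappa>(3) by simp
      then obtain u where u: "0 < u" and opt: "\<kappa> / (\<beta> / (u * (b - a)) + (1 - \<beta>) / ((b - a) + u * (b - a)))
          - u * (b - a) = (b - a) * (1 - \<beta>) * (sqrt \<kappa> - sqrt (\<beta> / (1 - \<beta>) * (1 - \<kappa>)))\<^sup>2"
        using optimal_barrier[of \<beta> \<kappa> "b - a"] \<beta>01 \<kappa> ab by auto
      define p where "p = a - u * (b - a)"
      have pa: "p < a" using u ab by (simp add: p_def)
      have ap: "a - p = u * (b - a)" "b - p = (b - a) + u * (b - a)" by (simp_all add: p_def)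
      define \<phi> where "\<phi> = real t * (\<beta> / (a - p) + (1 - \<beta>) / (b - p))"
      have \<phi>0: "0 < \<phi>" unfolding \<phi>_def using \<beta>01 pa ab t by (intro mult_pos_pos add_pos_pos divide_pos_pos) auto
      have pg: "p * g c < 1" if c: "c < d" for c
      proof (cases "g c = 0")
        case False
        then have "0 < g c" using g[OF c] by simp
        then have "p * g c < a * g c" using pa by simp
        also have "\<dots> \<le> a * lam 1" using le1[OF c] ab by (intro mult_left_mono) auto
        also have "\<dots> = 1" using l1 by (simp add: a_def)
        finally show ?thesis .
      qed simp
      have "(\<Sum>c<d. g c / (1 - p * g c)) = (\<Sum>i = 1..t. lam i / (1 - p * lam i))"
        by (rule sum_lam) simp
      also have "\<dots> = (\<Sum>i = 1..t. 1 / (r i - p))"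
      proof (intro sum.cong refl)
        fix i assume "i \<in> {1..t}"
        then have "0 < lam i" using lam_pos by auto
        then have "r i - p = (1 - p * lam i) / lam i" by (simp add: r_def field_simps)
        then show "lam i / (1 - p * lam i) = 1 / (r i - p)" by simp
      qed
      \<comment> \<open>The chord weights add up to \<open>real t * \<beta>\<close> at
        \<open>a\<close> and \<open>real t * (1 - \<beta>)\<close> at \<open>b\<close>, since the
        mean of the \<open>r i\<close> is \<open>m\<close>.\<close>
      also have "\<dots> \<le> (\<Sum>i = 1..t. ((b - r i) / (b - a)) / (a - p) + ((r i - a) / (b - a)) / (b - p))"
        using r ab pa by (intro sum_mono inverse_le_chord) auto
      also have "\<dots> = (\<Sum>i = 1..t. b - r i) / (b - a) / (a - p) + (\<Sum>i = 1..t. r i - a) / (b - a) / (b - p)"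
        by (simp only: sum.distrib sum_divide_distrib)
      also have "(\<Sum>i = 1..t. b - r i) / (b - a) = real t * \<beta>"
        unfolding sum_subtractf m[symmetric] by (simp add: \<beta> right_diff_distrib)
      also have "(\<Sum>i = 1..t. r i - a) / (b - a) = real t * (1 - \<beta>)"
      proof -
        have "(\<Sum>i = 1..t. r i - a) = real t * ((b - a) * (1 - \<beta>))"
          unfolding sum_subtractf m[symmetric] \<beta>m by (simp add: right_diff_distrib)
        then show ?thesis using ab by simp
      qed
      also have "real t * \<beta> / (a - p) + real t * (1 - \<beta>) / (b - p) = \<phi>"
        by (simp add: \<phi>_def distrib_left)
      finally have bound: "(\<Sum>c<d. g c / (1 - p * g c)) \<le> \<phi>" .
      have "real k / \<phi> = \<kappa> / (\<beta> / (a - p) + (1 - \<beta>) / (b - p))"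
        by (simp add: \<phi>_def \<kappa>_def)
      then have px: "p + real k / \<phi> = x"
        using opt unfolding ap \<gamma>[symmetric] \<beta>m by (simp add: x_def p_def)
      obtain S N where e: "eliminated d (gram A) S N" "card S = k"
        and q: "0 \<le> x \<longrightarrow> (\<forall>v. x * qform d N v \<le> (\<Sum>a<d. (v a)\<^sup>2))"
        using exists_eliminated[of A n d t k Q g p \<phi>, OF A rank k(1,3) Q g gr pg \<phi>0 bound]
        unfolding px by auto
      have "qform d N v \<le> 1 / x * (\<Sum>a<d. (v a)\<^sup>2)" for v
        using q x by (simp add: field_simps)
      with e show ?thesis by blast
    qed
    then obtain S N where e: "eliminated d (gram A) S N" and c: "card S = k"
      and qN: "\<And>v. qform d N v \<le> 1 / x * (\<Sum>a<d. (v a)\<^sup>2)" by blast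
    define E where "E = A - column_submatrix A S * pseudoinverse (column_submatrix A S) * A"
    have E: "E \<in> carrier_mat n d" unfolding E_def by (rule eliminated_projection_gram(1)[OF A e d d])
    have "qform d (gram E) v = qform d N v" for v
      unfolding qform_def E_def
      by (intro sum.cong refl) (simp add: eliminated_projection_gram(2)[OF A e])
    then have "(spectral_norm E)\<^sup>2 \<le> 1 / x"
      using qN x by (intro spectral_norm_sq_le[OF E]) simp_all
    moreover have "S \<subseteq> {0..<d}" using e by (auto simp: eliminated_def)
    moreover have "vec_space.rank n (column_submatrix A S) = k" using eliminated_rank[OF A e] c by simp
    ultimately show "\<exists>S \<subseteq> {0..<d}. card S = k \<and>
        vec_space.rank n (column_submatrix A S) = k \<and>
        (spectral_norm
          (A - column_submatrix A S * pseudoinverse (column_submatrix A S) * A))\<^sup>2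
        \<le> 1 / (1 + ((spectral_norm A)\<^sup>2 * inverse \<alpha> - 1) * \<gamma> k) * (spectral_norm A)\<^sup>2"
      unfolding rhs using c by (intro exI[of _ S]) (simp add: E_def)
  qed
  with \<beta>01 show ?thesis by simp
qed

end
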